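(* Let $n\in\mathbb{N}_+$ and let $\lambda,\mu$ be partitions. For $r\ge1$ and $c\ge1$ set \[a_r=\left\lfloor\frac{n|\lambda|-\sum_{i>r}\lambda_i}{r}\right\rfloor,\qquad b_c=\left\lfloor\frac{n|\lambda|-\sum_{j>c}\lambda'_j}{c}\right\rfloor.\] If $\langle s_\mu,\ p_n\circ s_\lambda\rangle\neq0$, then $\mu_r\le a_r$ for every $r\ge1$ and $\mu'_c\le b_c$ for every $c\ge1$. Equivalently, $[\mu]\subseteq[\Xi^1]\cap[\Xi^2]$, where $\Xi^1=(a_1,a_2,\dots)$ and $\Xi^2=(b_1,b_2,\dots)'$.
   Context: $\lambda'$ denotes the conjugate partition of $\lambda$, and $|\lambda|=\sum_i\lambda_i$. For a sequence $\alpha=(\alpha_1,\alpha_2,\dots)$ of nonnegative integers, $[\alpha]=\{(j,i)\in\mathbb{N}_0^2:0\le j<\alpha_{i+1}\}$. For a sequence $\beta=(b_1,b_2,\dots)$, $\beta'$ is understood via columns, so that $[(b_1,b_2,\dots)']=\{(j,i):0\le i<b_{j+1}\}$. $p_n$ is the $n$-th power sum, $\circ$ is plethysm, and $\langle\cdot,\cdot\rangle$ is the Hall inner product. *)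

theory Defs
  imports Main
begin

text \<open>Partitions are encoded 0-indexed: p i is the (i+1)-th part lambda_(i+1).\<close>

definition is_partition :: "(nat \<Rightarrow> nat) \<Rightarrow> bool" where
  "is_partition p \<longleftrightarrow> (\<forall>i. p (Suc i) \<le> p i) \<and> finite {i. p i \<noteq> 0}"

definition psize :: "(nat \<Rightarrow> nat) \<Rightarrow> nat" where
  "psize p = (\<Sum>i | p i \<noteq> 0. p i)"

definition conjp :: "(nat \<Rightarrow> nat) \<Rightarrow> nat \<Rightarrow> nat" where
  "conjp p j = card {i. j < p i}"

text \<open>ptail p r = sum of parts p_(i) with 1-indexed i > r.\<close>
definition ptail :: "(nat \<Rightarrow> nat) \<Rightarrow> nat \<Rightarrow> nat" where
  "ptail p r = (\<Sum>i | r \<le> i \<and> p i \<noteq> 0. p i)"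

text \<open>Semistandard Young tableaux of shape p with entries in {0..<N}
  (entry k stands for the variable x_(k+1)); T i j is the entry in row i, column j.\<close>
definition ssyt :: "nat \<Rightarrow> (nat \<Rightarrow> nat) \<Rightarrow> (nat \<Rightarrow> nat \<Rightarrow> nat) \<Rightarrow> bool" where
  "ssyt N p T \<longleftrightarrow>
     (\<forall>i j. \<not> j < p i \<longrightarrow> T i j = 0) \<and>
     (\<forall>i j. j < p i \<longrightarrow> T i j < N) \<and>
     (\<forall>i j. Suc j < p i \<longrightarrow> T i j \<le> T i (Suc j)) \<and>
     (\<forall>i j. j < p (Suc i) \<longrightarrow> T i j < T (Suc i) j)"

definition content :: "(nat \<Rightarrow> nat) \<Rightarrow> (nat \<Rightarrow> nat \<Rightarrow> nat) \<Rightarrow> nat \<Rightarrow> nat" where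
  "content p T k = card {(i, j). j < p i \<and> T i j = k}"

text \<open>Schur polynomial s_p(x_1,...,x_N), as a coefficient function on exponent vectors.\<close>
definition schur_poly :: "nat \<Rightarrow> (nat \<Rightarrow> nat) \<Rightarrow> (nat \<Rightarrow> nat) \<Rightarrow> int" where
  "schur_poly N p \<alpha> = int (card {T. ssyt N p T \<and> content p T = \<alpha>})"

text \<open>The plethysm p_n o s_p in N variables, i.e. s_p(x_1^n,...,x_N^n).\<close>
definition pleth_pn_schur :: "nat \<Rightarrow> nat \<Rightarrow> (nat \<Rightarrow> nat) \<Rightarrow> (nat \<Rightarrow> nat) \<Rightarrow> int" where
  "pleth_pn_schur N n p \<alpha> =
     (if (\<forall>k. n dvd \<alpha> k) then schur_poly N p (\<lambda>k. \<alpha> k div n) else 0)"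

text \<open>Coefficients of the Schur expansion of a homogeneous symmetric polynomial f of
  degree d in N variables (unique for N \<ge> d); the coefficient at mu is the Hall inner
  product with s_mu.\<close>
definition schur_coeff :: "nat \<Rightarrow> nat \<Rightarrow> ((nat \<Rightarrow> nat) \<Rightarrow> int) \<Rightarrow> (nat \<Rightarrow> nat) \<Rightarrow> int" where
  "schur_coeff N d f =
     (THE c. (\<forall>\<nu>. c \<nu> \<noteq> 0 \<longrightarrow> is_partition \<nu> \<and> psize \<nu> = d) \<and>
             (\<forall>\<alpha>. f \<alpha> = (\<Sum>\<nu> \<in> {\<nu>. is_partition \<nu> \<and> psize \<nu> = d}. c \<nu> * schur_poly N \<nu> \<alpha>)))"

text \<open>hall_pn_schur n lam mu = < s_mu , p_n o s_lam >, computed with n|lam| variables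
  (enough variables for the Schur functions of degree n|lam| to be independent).\<close>
definition hall_pn_schur :: "nat \<Rightarrow> (nat \<Rightarrow> nat) \<Rightarrow> (nat \<Rightarrow> nat) \<Rightarrow> int" where
  "hall_pn_schur n lam mu =
     schur_coeff (n * psize lam) (n * psize lam) (pleth_pn_schur (n * psize lam) n lam) mu"

end

(* Pairing with the s_mu is triangular in two ways. The coefficient of x^alpha in s_nu is
   a Kostka number, which vanishes unless alpha is dominated by nu; as every monomial of p_n o s_lam
   is x^(n alpha) with x^alpha a monomial of s_lam, a maximal constituent mu is dominated by n lam.
   For the columns, e_k is an alternating sum of products of h's, so pairing a symmetric function with
   e_kappa is an alternating sum of its monomial coefficients. On s_nu it counts chains of vertical
   strips and so vanishes unless kappa is dominated by nu'; on p_n o s_lam it is, up to sign, the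
   pairing of s_lam with e_(kappa/n). Hence mu' is dominated by n lam', and both bounds follow
   because mu and mu' are weakly decreasing. *)

theory Submission
  imports Defs
begin

subsection \<open>Partitions and horizontal strips\<close>

text \<open>No ring of symmetric functions is built. A symmetric function is a map \<open>F\<close>
  from lists of exponents to integers, \<open>F as\<close> being its pairing with h_as, that is, its
  coefficient at x^as. Lists leave the number of variables open and turn products of h's into
  concatenation, so that the e's become alternating sums over lists. \<open>hall_pn_schur\<close> is
  a definite description, so the Schur expansion of p_n o s_lam must be shown to exist and to be
  unique before anything can be said about a coefficient. Existence over the integers rests on the
  Kostka matrix being unitriangular and on Kostka numbers being symmetric in the letters. The column
  bound is not derived from the row bound by the involution omega. Partial sums of a conjugate are
  read as sizes of \<open>truncate c p\<close>, and a sign-reversing involution on chains of strips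
  shows that e_k removes vertical strips.\<close>

lemma initial_segment_eq_lessThan_card:
  fixes A :: "nat set"
  assumes fin: "finite A" and down: "\<And>a b. b \<in> A \<Longrightarrow> a \<le> b \<Longrightarrow> a \<in> A"
  shows "A = {..<card A}"
proof (cases "A = {}")
  case False
  have "A = {..Max A}" using Max_ge[OF fin] down[OF Max_in[OF fin False]] by blast
  thus ?thesis by (metis card_atMost lessThan_Suc_atMost)
qed simp

lemma psize_eq_sum:
  assumes "\<And>i. M \<le> i \<Longrightarrow> p i = 0"
  shows "psize p = (\<Sum>i<M. p i)"
  unfolding psize_def
  by (rule sum.mono_neutral_left) (use assms not_less in auto)

lemma partition_antimono:
  assumes "is_partition p" "i \<le> j"
  shows "p j \<le> p i"
  using assms lift_Suc_antimono_le[of p] by (auto simp: is_partition_def)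

lemma finite_support_bound:
  assumes "finite {i::nat. p i \<noteq> (0::nat)}"
  obtains M where "\<And>i. M \<le> i \<Longrightarrow> p i = 0"
proof -
  obtain M where "\<forall>i\<in>{i. p i \<noteq> 0}. i < M"
    using assms finite_nat_set_iff_bounded by blast
  thus ?thesis using that[of M] by (metis mem_Collect_eq not_less)
qed

lemma partition_bound:
  assumes "is_partition p"
  obtains M where "\<And>i. M \<le> i \<Longrightarrow> p i = 0"
  using assms finite_support_bound[of p] by (auto simp: is_partition_def)

lemma finite_functions_below:
  fixes p :: "nat \<Rightarrow> nat"
  assumes "\<And>i. M \<le> i \<Longrightarrow> p i = 0"
  shows "finite {q. \<forall>i. q i \<le> p i}"
proof (rule finite_subset)
  show "finite {q. \<forall>i. (i \<in> {..<M} \<longrightarrow> q i \<in> {..Max (p ` {..<M})}) \<and> (i \<notin> {..<M} \<longrightarrow> q i = 0)}"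
    by (rule finite_set_of_finite_funs) auto
  show "{q. \<forall>i. q i \<le> p i}
      \<subseteq> {q. \<forall>i. (i \<in> {..<M} \<longrightarrow> q i \<in> {..Max (p ` {..<M})}) \<and> (i \<notin> {..<M} \<longrightarrow> q i = 0)}"
  proof clarify
    fix q i assume q: "\<forall>i. q i \<le> p i"
    show "(i \<in> {..<M} \<longrightarrow> q i \<in> {..Max (p ` {..<M})}) \<and> (i \<notin> {..<M} \<longrightarrow> q i = 0)"
    proof (cases "i < M")
      case True
      then have "p i \<le> Max (p ` {..<M})" by simp
      with True q show ?thesis by (meson atMost_iff lessThan_iff order_trans)
    next
      case False
      then show ?thesis using q assms by (metis le_zero_eq lessThan_iff not_less)
    qed
  qed
qed

lemma psize_mono:
  assumes "\<And>i. q i \<le> p i" "\<And>i. M \<le> i \<Longrightarrow> p i = 0"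
  shows "psize q \<le> psize p"
proof -
  have "q i = 0" if "M \<le> i" for i using assms that by (metis le_zero_eq)
  thus ?thesis using assms by (simp add: psize_eq_sum[of M] sum_mono)
qed

lemma psize_mono_eq:
  assumes le: "\<And>i. q i \<le> p i" and M: "\<And>i. M \<le> i \<Longrightarrow> p i = 0" and eq: "psize q = psize p"
  shows "q = p"
proof (rule ext)
  fix i
  have q0: "q i = 0" if "M \<le> i" for i using le M that by (metis le_zero_eq)
  show "q i = p i"
  proof (rule ccontr)
    assume ne: "q i \<noteq> p i"
    hence "i < M" using q0 M by (metis not_less)
    hence "(\<Sum>i<M. q i) < (\<Sum>i<M. p i)"
      using le ne by (intro sum_strict_mono_ex1) (auto intro!: bexI[of _ i] le_neq_implies_less)
    thus False using eq by (simp add: psize_eq_sum[of M, OF q0] psize_eq_sum[of M, OF M])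
  qed
qed

lemma psize_zero_fun [simp]: "psize (\<lambda>_. 0) = 0"
  by (simp add: psize_def)

lemma partition_le_psize:
  assumes "is_partition p"
  shows "p i \<le> psize p" "psize p \<le> i \<Longrightarrow> p i = 0"
proof -
  obtain M where M: "\<And>i. M \<le> i \<Longrightarrow> p i = 0" using partition_bound[OF assms] by blast
  hence ps: "psize p = (\<Sum>i<max M (Suc i). p i)" by (intro psize_eq_sum) auto
  show "p i \<le> psize p" unfolding ps by (rule member_le_sum) auto
  assume i: "psize p \<le> i"
  show "p i = 0"
  proof (rule ccontr)
    assume "p i \<noteq> 0"
    hence "1 \<le> p j" if "j \<le> i" for j using partition_antimono[OF assms that] by linarith
    hence "(\<Sum>j<Suc i. 1) \<le> (\<Sum>j<Suc i. p j)" by (intro sum_mono) auto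
    also have "\<dots> \<le> psize p" unfolding ps by (rule sum_mono2) auto
    finally show False using i by simp
  qed
qed

lemma finite_partitions: "finite {p. is_partition p \<and> psize p = d}"
proof (rule finite_subset)
  show "finite {q. \<forall>i. q i \<le> (if i < d then d else 0)}"
    by (rule finite_functions_below[of d]) auto
  show "{p. is_partition p \<and> psize p = d} \<subseteq> {q. \<forall>i. q i \<le> (if i < d then d else 0)}"
    using partition_le_psize by (auto simp: not_less)
qed

section \<open>Horizontal and vertical strips\<close>

definition hstrip :: "(nat \<Rightarrow> nat) \<Rightarrow> (nat \<Rightarrow> nat) \<Rightarrow> bool" where
  "hstrip q p \<longleftrightarrow> (\<forall>i. q i \<le> p i \<and> p (Suc i) \<le> q i)"

definition hstrips :: "nat \<Rightarrow> (nat \<Rightarrow> nat) \<Rightarrow> (nat \<Rightarrow> nat) set" where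
  "hstrips k p = {q. hstrip q p \<and> psize q + k = psize p}"

text \<open>At most one cell of p/q lies in each row. Interlacing makes q weakly decreasing by
  itself; the row condition does not, so being a partition is demanded here.\<close>

definition vstrips :: "nat \<Rightarrow> (nat \<Rightarrow> nat) \<Rightarrow> (nat \<Rightarrow> nat) set" where
  "vstrips k p = {q. is_partition q \<and> (\<forall>i. q i \<le> p i \<and> p i \<le> Suc (q i)) \<and> psize q + k = psize p}"

lemma finite_strips:
  assumes "is_partition p"
  shows "finite {q. hstrip q p}" "finite (hstrips k p)" "finite (vstrips k p)"
proof -
  obtain M where "\<And>i. M \<le> i \<Longrightarrow> p i = 0" using partition_bound[OF assms] by blast
  hence "finite {q. \<forall>i. q i \<le> p i}" by (rule finite_functions_below)
  thus "finite {q. hstrip q p}" "finite (hstrips k p)" "finite (vstrips k p)"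
    by (auto simp: hstrips_def hstrip_def vstrips_def elim!: finite_subset[rotated])
qed

lemma hstrip_partition:
  assumes "is_partition p" "hstrip q p"
  shows "is_partition q"
proof -
  have le: "q i \<le> p i" "p (Suc i) \<le> q i" for i using assms by (auto simp: hstrip_def)
  have "{i. q i \<noteq> 0} \<subseteq> {i. p i \<noteq> 0}" using le by (metis (mono_tags, lifting) Collect_mono le_zero_eq)
  hence "finite {i. q i \<noteq> 0}" using assms(1) by (auto simp: is_partition_def intro: finite_subset)
  thus ?thesis unfolding is_partition_def using order_trans[OF le(1) le(2)] by blast
qed

lemma hstrips_partition: "is_partition p \<Longrightarrow> q \<in> hstrips k p \<Longrightarrow> is_partition q"
  by (auto simp: hstrips_def intro: hstrip_partition)

lemma vstrips_partition: "q \<in> vstrips k p \<Longrightarrow> is_partition q"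
  by (simp add: vstrips_def)

lemma hstrips_0:
  assumes "is_partition p"
  shows "hstrips 0 p = {p}"
proof -
  obtain M where M: "\<And>i. M \<le> i \<Longrightarrow> p i = 0" using partition_bound[OF assms] by blast
  have "q = p" if "q \<in> hstrips 0 p" for q
    using that by (intro psize_mono_eq[OF _ M]) (auto simp: hstrips_def hstrip_def)
  moreover have "p \<in> hstrips 0 p" using assms by (auto simp: hstrips_def hstrip_def is_partition_def)
  ultimately show ?thesis by auto
qed

lemma vstrips_0:
  assumes "is_partition p"
  shows "vstrips 0 p = {p}"
proof -
  obtain M where M: "\<And>i. M \<le> i \<Longrightarrow> p i = 0" using partition_bound[OF assms] by blast
  have "q = p" if "q \<in> vstrips 0 p" for q
    using that by (intro psize_mono_eq[OF _ M]) (auto simp: vstrips_def)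
  moreover have "p \<in> vstrips 0 p" using assms by (auto simp: vstrips_def)
  ultimately show ?thesis by auto
qed

text \<open>The adjoint of multiplication by h_as applied to s_p (Pieri rule), followed by the
  linear functional s_q -> \<open>g q\<close>. The free end \<open>g\<close> lets a list be cut at
  any point, which is what exchanging two letters in its middle requires.\<close>

fun hop :: "nat list \<Rightarrow> ((nat \<Rightarrow> nat) \<Rightarrow> int) \<Rightarrow> (nat \<Rightarrow> nat) \<Rightarrow> int" where
  "hop [] g p = g p"
| "hop (a # as) g p = (\<Sum>q\<in>hstrips a p. hop as g q)"

definition kostka :: "nat list \<Rightarrow> (nat \<Rightarrow> nat) \<Rightarrow> int" where
  "kostka as p = hop as (\<lambda>q. of_bool (q = (\<lambda>_. 0))) p"

text \<open>The pairing of s_p with e_as by the dual Pieri rule, that is, the Kostka number of the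
  conjugate shape.\<close>

fun kostka_conj :: "nat list \<Rightarrow> (nat \<Rightarrow> nat) \<Rightarrow> int" where
  "kostka_conj [] p = of_bool (p = (\<lambda>_. 0))"
| "kostka_conj (a # as) p = (\<Sum>q\<in>vstrips a p. kostka_conj as q)"

lemma hop_append: "hop (as @ bs) g p = hop as (hop bs g) p"
  by (induction as arbitrary: p) simp_all

lemma kostka_Nil [simp]: "kostka [] p = of_bool (p = (\<lambda>_. 0))"
  by (simp add: kostka_def)

lemma kostka_Cons [simp]: "kostka (a # as) p = (\<Sum>q\<in>hstrips a p. kostka as q)"
  by (simp add: kostka_def)

lemma hop_cong:
  assumes "\<And>q. is_partition q \<Longrightarrow> g q = h q" "is_partition p"
  shows "hop as g p = hop as h p"
  using assms(2) by (induction as arbitrary: p) (auto intro!: sum.cong assms(1) dest: hstrips_partition)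

text \<open>The Bender--Knuth involution on chains r, q, p of horizontal strips: each q i ranges over an
  interval determined by r and p alone, and is reflected in it.\<close>

lemma hop_commute2:
  assumes p: "is_partition p"
  shows "hop [a, b] g p = hop [b, a] g p"
proof -
  define lo where "lo r i = max (r i) (p (Suc i))" for r :: "nat \<Rightarrow> nat" and i
  define hi where "hi r i = min (p i) (case i of 0 \<Rightarrow> p 0 | Suc j \<Rightarrow> r j)" for r :: "nat \<Rightarrow> nat" and i
  define refl where "refl = (\<lambda>(q, r). (\<lambda>i. lo r i + hi r i - q i, r))"
  obtain M where M: "\<And>i. M \<le> i \<Longrightarrow> p i = 0" using partition_bound[OF p] by blast
  have between: "(\<forall>i. q i \<le> p i \<and> p (Suc i) \<le> q i) \<and> (\<forall>i. r i \<le> q i \<and> q (Suc i) \<le> r i)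
      \<longleftrightarrow> (\<forall>i. lo r i \<le> q i \<and> q i \<le> hi r i)" (is "?L = ?R") for q r
  proof
    assume ?L thus ?R by (auto simp: lo_def hi_def split: nat.splits)
  next
    assume R: ?R
    have "q (Suc i) \<le> r i" for i using R[rule_format, of "Suc i"] by (simp add: hi_def)
    thus ?L using R by (auto simp: lo_def hi_def)
  qed
  have refl_in: "refl x \<in> Sigma (hstrips d p) (hstrips c)" "refl (refl x) = x"
       "snd (refl x) = snd x"
    if "x \<in> Sigma (hstrips c p) (hstrips d)" for x c d
  proof -
    obtain q r where x: "x = (q, r)" by (cases x)
    have q: "\<And>i. q i \<le> p i" "\<And>i. p (Suc i) \<le> q i" "\<And>i. r i \<le> q i" "\<And>i. q (Suc i) \<le> r i"
      and sz: "psize q + c = psize p" "psize r + d = psize q"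
      using that by (auto simp: x hstrips_def hstrip_def)
    have lh: "lo r i \<le> q i" "q i \<le> hi r i" for i using between q by blast+
    define q' where "q' i = lo r i + hi r i - q i" for i
    have q'q: "q' i + q i = lo r i + hi r i" "lo r i \<le> q' i" "q' i \<le> hi r i" for i
      using lh[of i] by (auto simp: q'_def)
    have z: "q i = 0" "r i = 0" "q' i = 0" if "M \<le> i" for i
    proof -
      show *: "q i = 0" using q(1)[of i] M[OF that] by simp
      show "r i = 0" using q(3)[of i] * by simp
      show "q' i = 0" using q'q(3)[of i] M[OF that] by (simp add: hi_def)
    qed
    have "psize q' + psize q = (\<Sum>i<Suc M. q' i + q i)"
      unfolding sum.distrib using z by (intro arg_cong2[of _ _ _ _ "(+)"] psize_eq_sum) auto
    also have "\<dots> = (\<Sum>i<Suc M. lo r i) + (\<Sum>i<Suc M. hi r i)"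
      by (simp only: q'q(1) sum.distrib)
    also have "(\<Sum>i<Suc M. lo r i) = (\<Sum>i<M. lo r i)"
      using z M by (simp add: lo_def)
    also have "(\<Sum>i<Suc M. hi r i) = p 0 + (\<Sum>i<M. hi r (Suc i))"
      by (subst sum.lessThan_Suc_shift) (simp add: hi_def)
    also have "(\<Sum>i<M. lo r i) + (p 0 + (\<Sum>i<M. hi r (Suc i))) = (\<Sum>i<M. r i) + (p 0 + (\<Sum>i<M. p (Suc i)))"
    proof -
      \<comment> \<open>\<open>lo\<close> at row i and \<open>hi\<close> at row i+1 are the maximum
        and the minimum of the same pair \<open>r i\<close>, \<open>p (Suc i)\<close>, so together
        they sum to that pair.\<close>
      have "(\<Sum>i<M. lo r i) + (\<Sum>i<M. hi r (Suc i)) = (\<Sum>i<M. r i) + (\<Sum>i<M. p (Suc i))"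
        unfolding sum.distrib[symmetric] by (rule sum.cong) (auto simp: lo_def hi_def)
      thus ?thesis by simp
    qed
    also have "p 0 + (\<Sum>i<M. p (Suc i)) = (\<Sum>i<Suc M. p i)"
      by (rule sum.lessThan_Suc_shift[symmetric])
    also have "(\<Sum>i<M. r i) + (\<Sum>i<Suc M. p i) = psize r + psize p"
      using z M by (intro arg_cong2[of _ _ _ _ "(+)"] psize_eq_sum[symmetric]) auto
    finally have size: "psize q' + psize q = psize r + psize p" .
    have "(\<forall>i. q' i \<le> p i \<and> p (Suc i) \<le> q' i) \<and> (\<forall>i. r i \<le> q' i \<and> q' (Suc i) \<le> r i)"
      unfolding between using q'q by auto
    hence "(q', r) \<in> Sigma (hstrips d p) (hstrips c)"
      using sz size by (auto simp: hstrips_def hstrip_def)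
    thus "refl x \<in> Sigma (hstrips d p) (hstrips c)" by (simp add: refl_def x q'_def[abs_def])
    have "lo r i + hi r i - q' i = q i" for i using q'q(1)[of i] by simp
    thus "refl (refl x) = x" by (simp add: refl_def x q'_def)
    show "snd (refl x) = snd x" by (simp add: refl_def x)
  qed
  have as_pairs: "hop [c, d] g p = (\<Sum>x\<in>Sigma (hstrips c p) (hstrips d). g (snd x))" for c d
    using p by (simp add: sum.Sigma finite_strips hstrips_partition split_def)
  show ?thesis unfolding as_pairs
    by (rule sum.reindex_bij_witness[where i = refl and j = refl]) (auto simp: refl_in)
qed

lemma kostka_swap:
  assumes "is_partition p"
  shows "kostka (xs @ a # b # ys) p = kostka (xs @ b # a # ys) p"
proof -
  have "hop (a # b # ys) g = hop [a, b] (hop ys g)" for a b g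
    by (rule ext) simp
  hence "kostka (xs @ a # b # ys) p = hop xs (hop [a, b] (kostka ys)) p" for a b
    by (simp only: kostka_def[abs_def] hop_append)
  moreover have "hop xs (hop [a, b] (kostka ys)) p = hop xs (hop [b, a] (kostka ys)) p"
    using hop_commute2 assms by (rule hop_cong)
  ultimately show ?thesis by presburger
qed

text \<open>Insertion sort only exchanges neighbours; the prefix \<open>zs\<close> is carried so
  that the induction can pass under a fixed head.\<close>

lemma swap_invariant_sort:
  fixes F :: "nat list \<Rightarrow> 'a"
  assumes "\<And>xs a b ys. F (xs @ a # b # ys) = F (xs @ b # a # ys)"
  shows "F (sort xs) = F xs"
proof -
  have ins: "F (zs @ insort x ys) = F (zs @ x # ys)" for zs x ys
  proof (induction ys arbitrary: zs)
    case (Cons y ys)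
    from Cons[of "zs @ [y]"] assms[of zs x y ys] show ?case by simp
  qed simp
  have "F (zs @ sort xs) = F (zs @ xs)" for zs
  proof (induction xs arbitrary: zs)
    case (Cons x xs)
    from Cons[of "zs @ [x]"] ins[of zs x "sort xs"] show ?case by simp
  qed simp
  from this[of "[]"] show ?thesis by simp
qed

lemma kostka_0_Cons: "is_partition p \<Longrightarrow> kostka (0 # xs) p = kostka xs p"
  by (simp add: hstrips_0)

lemma kostka_sum_list:
  assumes "kostka xs p \<noteq> 0"
  shows "psize p = sum_list xs"
  using assms
proof (induction xs arbitrary: p)
  case (Cons x xs)
  then obtain q where "q \<in> hstrips x p" "kostka xs q \<noteq> 0"
    by (auto elim: sum.not_neutral_contains_not_neutral)
  with Cons.IH[of q] show ?case by (simp add: hstrips_def hstrip_def)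
qed auto

text \<open>The letters enter in decreasing order: the head of the list counts the largest letter.\<close>

abbreviation weight_list :: "nat \<Rightarrow> (nat \<Rightarrow> nat) \<Rightarrow> nat list" where
  "weight_list N w \<equiv> map w (rev [0..<N])"

lemma sum_list_weight_list: "sum_list (weight_list N w) = (\<Sum>i<N. w i)"
  by (induction N) (simp_all add: add.commute)

text \<open>From p to q the number of rows drops by at most one and no partial sum grows, so both
  claims pass from q to p, one letter at a time. The full sum, \<open>r = Suc N\<close>, is settled
  by comparing sizes.\<close>

lemma kostka_dominance:
  assumes "is_partition p" "kostka (weight_list N w) p \<noteq> 0"
  shows "\<forall>i\<ge>N. p i = 0" "\<forall>r\<le>N. (\<Sum>i<r. w i) \<le> (\<Sum>i<r. p i)"
proof -
  have "(\<forall>i\<ge>N. p i = 0) \<and> (\<forall>r\<le>N. (\<Sum>i<r. w i) \<le> (\<Sum>i<r. p i))"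
    using assms
  proof (induction N arbitrary: p)
    case (Suc N)
    then obtain q where q: "q \<in> hstrips (w N) p" "kostka (weight_list N w) q \<noteq> 0"
      by (auto elim: sum.not_neutral_contains_not_neutral)
    note IH = Suc.IH[OF hstrips_partition[OF Suc.prems(1) q(1)] q(2)]
    have le: "q i \<le> p i" "p (Suc i) \<le> q i" for i using q by (auto simp: hstrips_def hstrip_def)
    have z: "p i = 0" if "Suc N \<le> i" for i
      using IH le(2)[of "i - 1"] that by (cases i) auto
    have "(\<Sum>i<r. w i) \<le> (\<Sum>i<r. p i)" if "r \<le> Suc N" for r
    proof (cases "r = Suc N")
      case True
      have "psize p = (\<Sum>i<r. w i)"
        using kostka_sum_list[OF Suc.prems(2)] True by (simp only: sum_list_weight_list)
      thus ?thesis using psize_eq_sum[of "Suc N" p] z True by simp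
    next
      case False
      with that IH have "(\<Sum>i<r. w i) \<le> (\<Sum>i<r. q i)" by simp
      also have "\<dots> \<le> (\<Sum>i<r. p i)" by (intro sum_mono le)
      finally show ?thesis .
    qed
    with z show ?case by auto
  qed auto
  thus "\<forall>i\<ge>N. p i = 0" "\<forall>r\<le>N. (\<Sum>i<r. w i) \<le> (\<Sum>i<r. p i)" by auto
qed

lemma kostka_diagonal:
  assumes "is_partition p" "\<forall>i\<ge>N. p i = 0"
  shows "kostka (weight_list N p) p = 1"
proof -
  \<comment> \<open>The weight is any w agreeing with p below N: removing the last row changes the
    shape, while the list keeps its weight.\<close>
  have "kostka (weight_list N w) p = 1"
    if "is_partition p" "\<forall>i\<ge>N. p i = 0" "\<forall>i<N. w i = p i" for w
    using that
  proof (induction N arbitrary: p)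
    case (Suc N)
    \<comment> \<open>The remaining N letters fill at most N rows, so the whole last row must go in
      this one strip; every other strip contributes 0.\<close>
    define q where "q = p(N := 0)"
    have qp: "q i \<le> p i" "p (Suc i) \<le> q i" for i
      using Suc.prems by (auto simp: q_def is_partition_def)
    have sz: "psize p = (\<Sum>i<N. p i) + p N"
      using psize_eq_sum[of "Suc N" p] Suc.prems by simp
    have "psize q = (\<Sum>i<N. q i)" using Suc.prems by (intro psize_eq_sum) (auto simp: q_def)
    also have "\<dots> = (\<Sum>i<N. p i)" by (rule sum.cong) (auto simp: q_def)
    finally have q_in: "q \<in> hstrips (w N) p" using qp sz Suc.prems by (auto simp: hstrips_def hstrip_def)
    have q_part: "is_partition q" using hstrips_partition[OF Suc.prems(1) q_in] .
    have "kostka (weight_list N w) r = 0" if r: "r \<in> hstrips (w N) p - {q}" for r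
    proof (rule ccontr)
      assume "kostka (weight_list N w) r \<noteq> 0"
      moreover have "is_partition r" using hstrips_partition[OF Suc.prems(1)] r by auto
      ultimately have z: "\<forall>i\<ge>N. r i = 0" using kostka_dominance(1) by blast
      have "r = q"
      proof (rule psize_mono_eq)
        fix i show "r i \<le> q i" using r z by (cases "i < N") (auto simp: q_def hstrips_def hstrip_def)
        show "psize r = psize q" using r q_in by (auto simp: hstrips_def hstrip_def)
        show "q i = 0" if "N \<le> i" using Suc.prems that by (auto simp: q_def)
      qed
      thus False using r by simp
    qed
    hence "(\<Sum>r\<in>hstrips (w N) p. kostka (weight_list N w) r) = kostka (weight_list N w) q"
      using q_in by (subst sum.remove[OF finite_strips(2)[OF Suc.prems(1)] q_in]) simp
    also have "\<dots> = 1" using Suc.prems by (intro Suc.IH[OF q_part]) (auto simp: q_def)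
    finally show ?case by simp
  qed auto
  thus ?thesis using assms by blast
qed

subsection \<open>Semistandard tableaux as chains of horizontal strips\<close>

definition add_strip ::
  "nat \<Rightarrow> (nat \<Rightarrow> nat) \<Rightarrow> (nat \<Rightarrow> nat) \<Rightarrow> (nat \<Rightarrow> nat \<Rightarrow> nat) \<Rightarrow> nat \<Rightarrow> nat \<Rightarrow> nat" where
  "add_strip N p q T i j = (if j < q i then T i j else if j < p i then N else 0)"

lemma ssyt_add_strip:
  assumes T: "ssyt N q T" and qp: "hstrip q p"
  shows "ssyt (Suc N) p (add_strip N p q T)"
proof -
  have qp': "q i \<le> p i" "p (Suc i) \<le> q i" for i using qp by (auto simp: hstrip_def)
  have T': "\<not> j < q i \<Longrightarrow> T i j = 0" "j < q i \<Longrightarrow> T i j < N"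
    "Suc j < q i \<Longrightarrow> T i j \<le> T i (Suc j)" "j < q (Suc i) \<Longrightarrow> T i j < T (Suc i) j" for i j
    using T unfolding ssyt_def by blast+
  have *: "j < p i" if "j < q i" for i j using qp'(1)[of i] that by simp
  have "add_strip N p q T i j < add_strip N p q T (Suc i) j" if "j < p (Suc i)" for i j
  proof -
    have "j < q i" using that qp'(2)[of i] by simp
    thus ?thesis using that T'(2)[of j i] T'(4)[of j i] by (simp add: add_strip_def)
  qed
  moreover have "add_strip N p q T i j \<le> add_strip N p q T i (Suc j)" if "Suc j < p i" for i j
    using that T'(2)[of j i] T'(3)[of j i] by (auto simp: add_strip_def)
  moreover have "add_strip N p q T i j < Suc N" if "j < p i" for i j
    using that T'(2)[of j i] by (auto simp: add_strip_def)
  moreover have "add_strip N p q T i j = 0" if "\<not> j < p i" for i j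
    using that *[of j i] by (auto simp: add_strip_def)
  ultimately show ?thesis by (simp add: ssyt_def)
qed

lemma add_strip_shape:
  assumes "ssyt N q T" "hstrip q p"
  shows "q i = card {j. j < p i \<and> add_strip N p q T i j < N}"
proof -
  have "{j. j < p i \<and> add_strip N p q T i j < N} = {..<q i}"
    using assms unfolding ssyt_def hstrip_def
    by (auto simp: add_strip_def split: if_splits intro: less_le_trans)
  thus ?thesis by simp
qed

lemma add_strip_inj:
  assumes "ssyt N q T" "ssyt N q' T'" "hstrip q p" "hstrip q' p"
    and "add_strip N p q T = add_strip N p q' T'"
  shows "q = q'" "T = T'"
proof -
  show *: "q = q'"
    using add_strip_shape[OF assms(1,3)] add_strip_shape[OF assms(2,4)] assms(5) by auto
  show "T = T'"
  proof (intro ext)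
    fix i j
    have "\<not> j < q i \<Longrightarrow> T i j = 0" "\<not> j < q i \<Longrightarrow> T' i j = 0"
      using assms(1,2) * unfolding ssyt_def by blast+
    thus "T i j = T' i j" using fun_cong[OF fun_cong[OF assms(5)], of i j] *
      by (cases "j < q i") (auto simp: add_strip_def)
  qed
qed

text \<open>The cells with entry below N form a shape because rows increase weakly; those with entry
  N form a horizontal strip because columns increase strictly.\<close>

lemma ssyt_Suc_decompose:
  assumes p: "is_partition p" and T: "ssyt (Suc N) p T"
  obtains q T' where "hstrip q p" "ssyt N q T'" "T = add_strip N p q T'"
proof -
  have T': "\<not> j < p i \<Longrightarrow> T i j = 0" "j < p i \<Longrightarrow> T i j \<le> N"
    "Suc j < p i \<Longrightarrow> T i j \<le> T i (Suc j)" "j < p (Suc i) \<Longrightarrow> T i j < T (Suc i) j" for i j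
    using T unfolding ssyt_def less_Suc_eq_le by blast+
  define q where "q i = card {j. j < p i \<and> T i j < N}" for i
  define U where "U i j = (if j < q i then T i j else 0)" for i j
  have row: "T i j \<le> T i k" if "j \<le> k" "k < p i" for i j k
    using that
  proof (induction k)
    case (Suc k)
    thus ?case using T'(3)[of k i] by (cases "j = Suc k") auto
  qed simp
  have mem: "j < p i \<and> T i j < N \<longleftrightarrow> j < q i" for i j
  proof -
    define S where "S = {j. j < p i \<and> T i j < N}"
    have fin: "finite S" unfolding S_def by simp
    have down: "j \<in> S" if "k \<in> S" "j \<le> k" for j k
      using that row[of j k i] unfolding S_def by auto
    have "S = {..<card S}" using fin down by (rule initial_segment_eq_lessThan_card)
    thus ?thesis unfolding q_def S_def by blast
  qed
  have qp: "hstrip q p" unfolding hstrip_def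
  proof (intro allI conjI)
    fix i
    show "q i \<le> p i" using mem[of "p i" i] by (simp add: not_less)
    show "p (Suc i) \<le> q i"
    proof (rule ccontr)
      assume "\<not> p (Suc i) \<le> q i"
      hence lt: "q i < p (Suc i)" by simp
      hence "T i (q i) < N" using T'(2)[of "q i" "Suc i"] T'(4)[of "q i" i] by simp
      moreover have "q i < p i" using lt p by (auto simp: is_partition_def intro: less_le_trans)
      ultimately show False using mem[of "q i" i] by simp
    qed
  qed
  have "j < q i" if "j < q (Suc i)" for i j
    using that qp by (auto simp: hstrip_def intro: less_le_trans order_trans)
  moreover have "j < p i" "T i j < N" if "j < q i" for i j using mem[of j i] that by auto
  ultimately have "ssyt N q U" unfolding ssyt_def
    by (auto simp: U_def intro: T'(3,4))
  moreover have "T = add_strip N p q U"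
  proof (intro ext)
    fix i j show "T i j = add_strip N p q U i j"
      using mem[of j i] T'(1,2)[of j i] by (auto simp: add_strip_def U_def)
  qed
  ultimately show ?thesis using that qp by blast
qed

lemma finite_ssyt:
  assumes "is_partition p"
  shows "finite {T. ssyt N p T}"
  using assms
proof (induction N arbitrary: p)
  case 0
  have "{T. ssyt 0 p T} \<subseteq> {\<lambda>_ _. 0}" by (auto simp: ssyt_def fun_eq_iff)
  thus ?case by (rule finite_subset) simp
next
  case (Suc N)
  have "{T. ssyt (Suc N) p T} \<subseteq> (\<Union>q\<in>{q. hstrip q p}. add_strip N p q ` {T. ssyt N q T})"
    using Suc.prems by (blast elim: ssyt_Suc_decompose)
  moreover have "finite \<dots>"
    using Suc finite_strips(1) hstrip_partition by (intro finite_UN_I finite_imageI) auto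
  ultimately show ?case by (rule finite_subset)
qed

lemma finite_cells:
  assumes "is_partition p"
  shows "finite {(i, j). j < p i}" "card {(i, j). j < p i} = psize p"
proof -
  obtain M where M: "\<And>i. M \<le> i \<Longrightarrow> p i = 0" using partition_bound[OF assms] by blast
  have "i < M" if "j < p i" for i j using M[of i] that by (cases "i < M") auto
  hence *: "{(i, j). j < p i} = Sigma {..<M} (\<lambda>i. {..<p i})" by auto
  show "finite {(i, j). j < p i}" "card {(i, j). j < p i} = psize p"
    unfolding * using psize_eq_sum[of M p] M by auto
qed

lemma content_add_strip:
  assumes p: "is_partition p" and qp: "hstrip q p" and T: "ssyt N q T"
  shows "content p (add_strip N p q T) = (content q T)(N := psize p - psize q)"
proof
  fix k
  have le: "j < p i" if "j < q i" for i j
    using that qp by (auto simp: hstrip_def intro: less_le_trans)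
  have lt: "T i j < N" if "j < q i" for i j using that T by (auto simp: ssyt_def)
  show "content p (add_strip N p q T) k = ((content q T)(N := psize p - psize q)) k"
  proof (cases "k = N")
    case True
    have "{(i, j). j < p i \<and> add_strip N p q T i j = k} = {(i, j). j < p i} - {(i, j). j < q i}"
      using lt True by (force simp: add_strip_def)
    moreover have "card \<dots> = psize p - psize q"
      using finite_cells[OF p] finite_cells[OF hstrip_partition[OF p qp]] le
      by (subst card_Diff_subset) auto
    ultimately show ?thesis using True by (simp add: content_def)
  next
    case False
    hence "{(i, j). j < p i \<and> add_strip N p q T i j = k} = {(i, j). j < q i \<and> T i j = k}"
      using le by (auto simp: add_strip_def split: if_splits)
    thus ?thesis using False by (simp add: content_def)
  qed
qed

lemma content_last:
  assumes "ssyt N q T" "N \<le> k"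
  shows "content q T k = 0"
proof -
  have "{(i, j). j < q i \<and> T i j = k} = {}" using assms by (fastforce simp: ssyt_def)
  thus ?thesis unfolding content_def by (metis card.empty)
qed

text \<open>Branching rule: delete the cells holding the largest letter N. A tableau with entries
  below N has exponent 0 at N, hence \<open>w(N := 0)\<close>. The union is disjoint because the
  inner shape can be read off the filled tableau.\<close>

lemma schur_poly_Suc:
  assumes p: "is_partition p"
  shows "schur_poly (Suc N) p w = (\<Sum>q\<in>hstrips (w N) p. schur_poly N q (w(N := 0)))"
proof -
  let ?A = "\<lambda>q. {T. ssyt N q T \<and> content q T = w(N := 0)}"
  have "{T. ssyt (Suc N) p T \<and> content p T = w} = (\<Union>q\<in>hstrips (w N) p. add_strip N p q ` ?A q)"
  proof (intro equalityI subsetI)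
    fix T assume "T \<in> {T. ssyt (Suc N) p T \<and> content p T = w}"
    hence T: "ssyt (Suc N) p T" "content p T = w" by auto
    obtain q U where q: "hstrip q p" "ssyt N q U" "T = add_strip N p q U"
      using ssyt_Suc_decompose[OF p T(1)] by blast
    obtain M where M: "\<And>i. M \<le> i \<Longrightarrow> p i = 0" using partition_bound[OF p] by blast
    have "psize q \<le> psize p" using q(1) M by (intro psize_mono[of q p M]) (auto simp: hstrip_def)
    moreover have w: "w = (content q U)(N := psize p - psize q)"
      using content_add_strip[OF p q(1,2)] T(2) q(3) by simp
    ultimately have "q \<in> hstrips (w N) p" using q(1) by (simp add: hstrips_def)
    moreover have "content q U = w(N := 0)"
      using content_last[OF q(2), of N] unfolding w by (auto simp: fun_eq_iff)
    ultimately show "T \<in> (\<Union>q\<in>hstrips (w N) p. add_strip N p q ` ?A q)" using q by blast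
  next
    fix T assume "T \<in> (\<Union>q\<in>hstrips (w N) p. add_strip N p q ` ?A q)"
    then obtain q U where q: "hstrip q p" "psize q + w N = psize p" "ssyt N q U"
      "content q U = w(N := 0)" "T = add_strip N p q U" by (auto simp: hstrips_def)
    have "psize p - psize q = w N" using q(2) by simp
    hence "content p T = w" using content_add_strip[OF p q(1,3)] q(4,5) by simp
    thus "T \<in> {T. ssyt (Suc N) p T \<and> content p T = w}"
      using ssyt_add_strip[OF q(3,1)] q(5) by simp
  qed
  moreover have "card (\<Union>q\<in>hstrips (w N) p. add_strip N p q ` ?A q)
      = (\<Sum>q\<in>hstrips (w N) p. card (add_strip N p q ` ?A q))"
  proof (rule card_UN_disjoint)
    show "finite (hstrips (w N) p)" using finite_strips(2)[OF p] .
    show "\<forall>q\<in>hstrips (w N) p. finite (add_strip N p q ` ?A q)"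
    proof
      fix q assume "q \<in> hstrips (w N) p"
      hence "finite {T. ssyt N q T}" by (intro finite_ssyt hstrips_partition[OF p])
      thus "finite (add_strip N p q ` ?A q)" by simp
    qed
    show "\<forall>q\<in>hstrips (w N) p. \<forall>q'\<in>hstrips (w N) p. q \<noteq> q' \<longrightarrow>
        add_strip N p q ` ?A q \<inter> add_strip N p q' ` ?A q' = {}"
    proof (intro ballI impI equals0I)
      fix q q' T
      assume "q \<in> hstrips (w N) p" "q' \<in> hstrips (w N) p" "q \<noteq> q'"
        "T \<in> add_strip N p q ` ?A q \<inter> add_strip N p q' ` ?A q'"
      then obtain U U' where "ssyt N q U" "ssyt N q' U'" "hstrip q p" "hstrip q' p"
        "add_strip N p q U = add_strip N p q' U'" by (auto simp: hstrips_def)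
      thus False using \<open>q \<noteq> q'\<close> add_strip_inj(1) by blast
    qed
  qed
  moreover have "card (add_strip N p q ` ?A q) = card (?A q)" if "q \<in> hstrips (w N) p" for q
    using add_strip_inj(2)[of N q _ q _ p] that by (intro card_image inj_onI) (simp add: hstrips_def)
  ultimately show ?thesis by (simp add: schur_poly_def)
qed

text \<open>\<open>weight_list N w\<close> sees only the first N exponents, so the vanishing of the
  others is a separate condition.\<close>

lemma schur_poly_eq_kostka:
  assumes "is_partition p"
  shows "schur_poly N p w = (if \<forall>k\<ge>N. w k = 0 then kostka (weight_list N w) p else 0)"
  using assms
proof (induction N arbitrary: p w)
  case 0
  have "{T. ssyt 0 p T \<and> content p T = w} = (if p = (\<lambda>_. 0) \<and> w = (\<lambda>_. 0) then {\<lambda>_ _. 0} else {})"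
  proof -
    have "ssyt 0 p T \<longleftrightarrow> p = (\<lambda>_. 0) \<and> T = (\<lambda>_ _. 0)" for T
    proof
      assume "ssyt 0 p T"
      hence "\<not> 0 < p i" "T i j = 0" for i j by (auto simp: ssyt_def)
      thus "p = (\<lambda>_. 0) \<and> T = (\<lambda>_ _. 0)" by (simp add: fun_eq_iff)
    qed (simp add: ssyt_def)
    moreover have "content (\<lambda>_. 0) T = (\<lambda>_. 0)" for T by (auto simp: content_def)
    ultimately show ?thesis by auto
  qed
  hence "schur_poly 0 p w = of_bool (p = (\<lambda>_. 0) \<and> w = (\<lambda>_. 0))" by (simp add: schur_poly_def)
  moreover have "(\<forall>k\<ge>0. w k = 0) \<longleftrightarrow> w = (\<lambda>_. 0)" by auto
  ultimately show ?case by simp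
next
  case (Suc N)
  have "(N \<le> k \<longrightarrow> (w(N := 0)) k = 0) \<longleftrightarrow> (Suc N \<le> k \<longrightarrow> w k = 0)" for k
    by (cases "k = N") auto
  hence *: "(\<forall>k\<ge>N. (w(N := 0)) k = 0) \<longleftrightarrow> (\<forall>k\<ge>Suc N. w k = 0)"
    by (simp only:)
  have wl: "weight_list N (w(N := 0)) = weight_list N w" by simp
  have "schur_poly N q (w(N := 0)) = (if \<forall>k\<ge>Suc N. w k = 0 then kostka (weight_list N w) q else 0)"
    if "q \<in> hstrips (w N) p" for q
    using Suc.IH[OF hstrips_partition[OF Suc.prems that], of "w(N := 0)"] unfolding * wl .
  hence "schur_poly (Suc N) p w
      = (\<Sum>q\<in>hstrips (w N) p. if \<forall>k\<ge>Suc N. w k = 0 then kostka (weight_list N w) q else 0)"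
    unfolding schur_poly_Suc[OF Suc.prems] by (intro sum.cong refl)
  also have "\<dots> = (if \<forall>k\<ge>Suc N. w k = 0 then kostka (weight_list (Suc N) w) p else 0)"
    by (auto intro!: sum.neutral)
  finally show ?case .
qed

subsection \<open>Triangular systems\<close>

text \<open>What the row and the column argument share. The diagonal is asked to be nonzero rather
  than 1 because for vertical strips only its positivity is established; with
  \<open>nonzero_le\<close> it also gives reflexivity of \<open>le\<close> on
  \<open>S\<close>.\<close>

locale triangular =
  fixes S :: "'a set" and le :: "'a \<Rightarrow> 'a \<Rightarrow> bool" and K :: "'a \<Rightarrow> 'a \<Rightarrow> int"
  assumes finite: "finite S"
    and le_trans: "\<And>x y z. le x y \<Longrightarrow> le y z \<Longrightarrow> le x z"
    and le_antisym: "\<And>x y. x \<in> S \<Longrightarrow> y \<in> S \<Longrightarrow> le x y \<Longrightarrow> le y x \<Longrightarrow> x = y"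
    and nonzero_le: "\<And>x y. x \<in> S \<Longrightarrow> y \<in> S \<Longrightarrow> K x y \<noteq> 0 \<Longrightarrow> le y x"
    and diag: "\<And>x. x \<in> S \<Longrightarrow> K x x \<noteq> 0"
begin

lemma maximal_exists:
  assumes "A \<subseteq> S" "A \<noteq> {}"
  shows "\<exists>m\<in>A. \<forall>x\<in>A. le m x \<longrightarrow> x = m"
proof -
  have "\<exists>m\<in>A. \<forall>x\<in>A. x \<noteq> m \<longrightarrow> \<not> (le m x \<and> m \<noteq> x)"
  proof (rule Finite_Set.bex_max_element)
    show "finite A" using assms finite finite_subset by blast
    show "asymp_on A (\<lambda>x y. le x y \<and> x \<noteq> y)"
      using assms le_antisym by (auto intro!: asymp_onI)
    show "transp_on A (\<lambda>x y. le x y \<and> x \<noteq> y)"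
      using assms le_antisym le_trans by (intro transp_onI) (metis in_mono)
  qed (use assms in auto)
  thus ?thesis by blast
qed

text \<open>Among the x above m with \<open>c x \<noteq> 0\<close> take a maximal v. In the sum at v
  only the term x = v survives, so P holds at v and descends to m. It serves with P a dominance
  bound, and with P constantly false to prove coefficients unique.\<close>

lemma support_subset:
  assumes F: "\<And>y. y \<in> S \<Longrightarrow> (\<Sum>x\<in>S. c x * K x y) \<noteq> 0 \<Longrightarrow> P y"
    and down: "\<And>x y. P x \<Longrightarrow> le y x \<Longrightarrow> P y"
    and m: "m \<in> S" "c m \<noteq> 0"
  shows "P m"
proof -
  define A where "A = {x \<in> S. c x \<noteq> 0 \<and> le m x}"
  have "m \<in> A" using m diag nonzero_le by (auto simp: A_def)
  then obtain v where v: "v \<in> A" and max: "\<And>x. x \<in> A \<Longrightarrow> le v x \<Longrightarrow> x = v"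
    using maximal_exists[of A] by (auto simp: A_def)
  have "c x * K x v = 0" if x: "x \<in> S - {v}" for x
  proof (rule ccontr)
    assume "c x * K x v \<noteq> 0"
    hence "le v x" "c x \<noteq> 0" using x v nonzero_le by (auto simp: A_def)
    hence "x \<in> A" using x v le_trans by (auto simp: A_def)
    thus False using max \<open>le v x\<close> x by auto
  qed
  hence "(\<Sum>x\<in>S - {v}. c x * K x v) = 0" by (rule sum.neutral[OF ballI])
  hence "(\<Sum>x\<in>S. c x * K x v) = c v * K v v"
    using v finite by (subst sum.remove[of S v]) (auto simp: A_def)
  hence "P v" using F[of v] v diag by (auto simp: A_def)
  thus "P m" using down v by (auto simp: A_def)
qed

text \<open>Back substitution without division: for a maximal m in A, \<open>K x m = 0\<close> for
  every other x in A, so \<open>c m\<close> must be \<open>f m\<close>, and what remains is a system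
  on \<open>A - {m}\<close>.\<close>

lemma solution_exists:
  assumes unit: "\<And>x. x \<in> S \<Longrightarrow> K x x = 1"
  shows "\<exists>c. \<forall>y\<in>S. f y = (\<Sum>x\<in>S. c x * K x y)"
proof -
  have "\<exists>c. \<forall>y\<in>A. f y = (\<Sum>x\<in>A. c x * K x y)" if "A \<subseteq> S" for A
    using that
  proof (induction "card A" arbitrary: A f)
    case 0
    hence "A = {}" using finite finite_subset by fastforce
    thus ?case by simp
  next
    case (Suc k)
    have "A \<noteq> {}" using Suc.hyps(2) by auto
    then obtain m where m: "m \<in> A" and max: "\<And>x. x \<in> A \<Longrightarrow> le m x \<Longrightarrow> x = m"
      using maximal_exists[OF Suc.prems] by blast
    have fin: "Finite_Set.finite A" using Suc.prems finite finite_subset by blast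
    have "k = card (A - {m})" using Suc.hyps(2) m by simp
    then obtain c where c: "\<And>y. y \<in> A - {m} \<Longrightarrow> f y - f m * K m y = (\<Sum>x\<in>A - {m}. c x * K x y)"
      using Suc.hyps(1)[of "A - {m}" "\<lambda>y. f y - f m * K m y"] Suc.prems by blast
    have split: "(\<Sum>x\<in>A. (c(m := f m)) x * K x y) = f m * K m y + (\<Sum>x\<in>A - {m}. c x * K x y)" for y
      by (subst sum.remove[OF fin m]) (auto intro!: sum.cong)
    have zero: "K x m = 0" if "x \<in> A - {m}" for x
      using that max[of x] nonzero_le[of x m] m Suc.prems by auto
    have "f y = (\<Sum>x\<in>A. (c(m := f m)) x * K x y)" if "y \<in> A" for y
    proof (cases "y = m")
      case True
      thus ?thesis unfolding split using unit m Suc.prems zero by (auto simp: subset_iff)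
    next
      case False
      thus ?thesis unfolding split using c[of y] that by simp
    qed
    thus ?case by blast
  qed
  thus ?thesis by blast
qed

end

subsection \<open>Schur expansions\<close>

abbreviation partitions_of :: "nat \<Rightarrow> (nat \<Rightarrow> nat) set" where
  "partitions_of d \<equiv> {p. is_partition p \<and> psize p = d}"

lemma partition_sum_lessThan:
  assumes "is_partition p" "psize p \<le> r"
  shows "(\<Sum>i<r. p i) = psize p"
  using psize_eq_sum[of r p] partition_le_psize(2)[OF assms(1)] assms(2) by auto

lemma triangular_dominance:
  "triangular (partitions_of d) (\<lambda>p q. \<forall>r. (\<Sum>i<r. p i) \<le> (\<Sum>i<r. q i))
     (\<lambda>p q. kostka (weight_list d q) p)"
proof
  show "Finite_Set.finite (partitions_of d)" by (rule finite_partitions)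
  show "\<forall>r. (\<Sum>i<r. p i) \<le> (\<Sum>i<r. s i)"
    if "\<forall>r. (\<Sum>i<r. p i) \<le> (\<Sum>i<r. q i)" "\<forall>r. (\<Sum>i<r. q i) \<le> (\<Sum>i<r. s i)"
    for p q s :: "nat \<Rightarrow> nat" using that order_trans by blast
  show "p = q"
    if "\<forall>r. (\<Sum>i<r. p i) \<le> (\<Sum>i<r. q i)" "\<forall>r. (\<Sum>i<r. q i) \<le> (\<Sum>i<r. p i)"
    for p q :: "nat \<Rightarrow> nat"
  proof
    fix i
    have eq: "(\<Sum>i<r. p i) = (\<Sum>i<r. q i)" for r using that by (simp add: le_antisym)
    show "p i = q i" using eq[of i] eq[of "Suc i"] by simp
  qed
  show "\<forall>r. (\<Sum>i<r. q i) \<le> (\<Sum>i<r. p i)"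
    if "p \<in> partitions_of d" "q \<in> partitions_of d" "kostka (weight_list d q) p \<noteq> 0" for p q
  proof
    fix r
    \<comment> \<open>Past d rows both partial sums equal d.\<close>
    show "(\<Sum>i<r. q i) \<le> (\<Sum>i<r. p i)"
      using that kostka_dominance(2)[of p q d] partition_sum_lessThan[of p r] partition_sum_lessThan[of q r]
      by (cases "r \<le> d") auto
  qed
  show "kostka (weight_list d p) p \<noteq> 0" if "p \<in> partitions_of d" for p
    using that kostka_diagonal[of p d] partition_le_psize(2)[of p] by auto
qed

text \<open>A symmetric function of degree d is determined by its coefficients at partitions of d:
  sorting a list and adding or dropping zeros gives the weight list of one.\<close>

lemma zero_on_weights_of_partitions:
  fixes F :: "nat list \<Rightarrow> int"
  assumes swap: "\<And>xs a b ys. F (xs @ a # b # ys) = F (xs @ b # a # ys)"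
    and zero: "\<And>xs. F (0 # xs) = F xs"
    and degree: "\<And>xs. F xs \<noteq> 0 \<Longrightarrow> sum_list xs = d"
    and partition: "\<And>p. p \<in> partitions_of d \<Longrightarrow> F (weight_list d p) = 0"
  shows "F xs = 0"
proof (rule ccontr)
  assume nz: "F xs \<noteq> 0"
  define ys where "ys = sort xs"
  \<comment> \<open>\<open>weight_list\<close> reads a weight backwards, so the increasing list
    \<open>ys\<close> comes from a decreasing p.\<close>
  define p where "p i = (if i < length ys then rev ys ! i else 0)" for i
  have wl: "weight_list (length ys) p = ys"
    unfolding rev_map[symmetric] by (rule nth_equalityI) (auto simp: p_def rev_nth)
  have dec: "rev ys ! Suc i \<le> rev ys ! i" if "Suc i < length ys" for i
    using that sorted_nth_mono[of ys "length ys - Suc (Suc i)" "length ys - Suc i"]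
    by (simp add: rev_nth ys_def)
  have p: "is_partition p" unfolding is_partition_def
  proof
    show "\<forall>i. p (Suc i) \<le> p i" using dec by (auto simp: p_def)
    show "finite {i. p i \<noteq> 0}" by (rule finite_subset[of _ "{..<length ys}"]) (auto simp: p_def)
  qed
  have "sum_list ys = sum_list xs"
    unfolding ys_def by (rule swap_invariant_sort) simp
  moreover have "psize p = sum_list (weight_list (length ys) p)"
    unfolding sum_list_weight_list by (rule psize_eq_sum) (simp add: p_def)
  ultimately have ps: "psize p = d" using degree[OF nz] wl by simp
  \<comment> \<open>\<open>length ys\<close> may lie on either side of d, so both lists are compared
    with the one of length \<open>d + length ys\<close>.\<close>
  have pad: "F (weight_list (m + j) p) = F (weight_list m p)" if "\<And>i. m \<le> i \<Longrightarrow> p i = 0" for m j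
    using that zero by (induction j) auto
  have "F (weight_list d p) = F (weight_list (length ys) p)"
    using pad[of d "length ys"] pad[of "length ys" d] partition_le_psize(2)[OF p] ps
    by (simp add: add.commute p_def)
  also have "\<dots> = F (sort xs)" unfolding wl by (simp only: ys_def)
  also have "\<dots> = F xs" by (rule swap_invariant_sort) (rule swap)
  finally show False using partition p ps nz by auto
qed

text \<open>The coefficients are solved for at the partitions of d, where the Kostka matrix is
  unitriangular. The difference of the two sides is again symmetric of degree d and vanishes at
  those weights.\<close>

lemma kostka_expansion_exists:
  fixes F :: "nat list \<Rightarrow> int"
  assumes swap: "\<And>xs a b ys. F (xs @ a # b # ys) = F (xs @ b # a # ys)"
    and zero: "\<And>xs. F (0 # xs) = F xs"
    and degree: "\<And>xs. F xs \<noteq> 0 \<Longrightarrow> sum_list xs = d"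
  shows "\<exists>c. \<forall>xs. F xs = (\<Sum>p\<in>partitions_of d. c p * kostka xs p)"
proof -
  have "kostka (weight_list d p) p = 1" if "p \<in> partitions_of d" for p
    using that partition_le_psize(2)[of p] by (auto intro!: kostka_diagonal)
  then obtain c where c: "\<And>q. q \<in> partitions_of d \<Longrightarrow>
      F (weight_list d q) = (\<Sum>p\<in>partitions_of d. c p * kostka (weight_list d q) p)"
    using triangular.solution_exists[OF triangular_dominance[of d], of "\<lambda>q. F (weight_list d q)"]
    by blast
  define G where "G xs = F xs - (\<Sum>p\<in>partitions_of d. c p * kostka xs p)" for xs
  have "G xs = 0" for xs
  proof (rule zero_on_weights_of_partitions[where F = G])
    show "G (xs @ a # b # ys) = G (xs @ b # a # ys)" for xs a b ys
      unfolding G_def swap[of xs a b ys] using kostka_swap[of _ xs a b ys] by simp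
    show "G (0 # xs) = G xs" for xs
      unfolding G_def zero using kostka_0_Cons[of _ xs] by (simp del: kostka_Cons)
    show "G (weight_list d p) = 0" if "p \<in> partitions_of d" for p
      unfolding G_def c[OF that] by (rule diff_self)
    show "sum_list xs = d" if "G xs \<noteq> 0" for xs
    proof (rule ccontr)
      assume *: "sum_list xs \<noteq> d"
      have "kostka xs p = 0" if "p \<in> partitions_of d" for p
        using that * kostka_sum_list[of xs p] by auto
      moreover have "F xs = 0" using degree[of xs] * by blast
      ultimately have "G xs = 0" unfolding G_def by simp
      thus False using that by contradiction
    qed
  qed
  hence "F xs = (\<Sum>p\<in>partitions_of d. c p * kostka xs p)" for xs
    unfolding G_def using right_minus_eq by blast
  thus ?thesis by blast
qed

section \<open>Adams operations: the substitution x_i -> x_i^n on monomial coefficients\<close>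

definition adams :: "nat \<Rightarrow> (nat list \<Rightarrow> int) \<Rightarrow> nat list \<Rightarrow> int" where
  "adams n F as = (if \<forall>a\<in>set as. n dvd a then F (map (\<lambda>a. a div n) as) else 0)"

lemma sum_list_div_dvd:
  "\<forall>a\<in>set as. n dvd a \<Longrightarrow> n * sum_list (map (\<lambda>a. a div n) as) = sum_list (as :: nat list)"
  by (induction as) (auto simp: distrib_left)

lemma adams_kostka_expansion:
  assumes "is_partition p"
  shows "\<exists>c. \<forall>xs. adams n (\<lambda>as. kostka as p) xs
      = (\<Sum>q\<in>partitions_of (n * psize p). c q * kostka xs q)"
proof (rule kostka_expansion_exists)
  show "adams n (\<lambda>as. kostka as p) (xs @ a # b # ys) = adams n (\<lambda>as. kostka as p) (xs @ b # a # ys)"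
    for xs a b ys
    using kostka_swap[OF assms, of "map (\<lambda>a. a div n) xs"] by (auto simp: adams_def)
  show "adams n (\<lambda>as. kostka as p) (0 # xs) = adams n (\<lambda>as. kostka as p) xs" for xs
    using kostka_0_Cons[OF assms] by (simp add: adams_def del: kostka_Cons)
  show "sum_list xs = n * psize p" if "adams n (\<lambda>as. kostka as p) xs \<noteq> 0" for xs
  proof -
    have "\<forall>a\<in>set xs. n dvd a" and nz: "kostka (map (\<lambda>a. a div n) xs) p \<noteq> 0"
      using that by (auto simp: adams_def split: if_splits)
    thus ?thesis using sum_list_div_dvd[of xs n] kostka_sum_list[OF nz] by simp
  qed
qed

lemma pleth_pn_schur_eq_adams:
  assumes "is_partition p" "n \<ge> 1"
  shows "pleth_pn_schur N n p w
    = (if \<forall>k\<ge>N. w k = 0 then adams n (\<lambda>as. kostka as p) (weight_list N w) else 0)"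
proof (cases "\<forall>k. n dvd w k")
  case True
  hence "w k div n = 0 \<longleftrightarrow> w k = 0" for k using assms(2) True by (metis dvd_div_eq_0_iff)
  thus ?thesis using True assms
    by (auto simp: pleth_pn_schur_def adams_def schur_poly_eq_kostka comp_def)
next
  case False
  then obtain k where k: "\<not> n dvd w k" by blast
  hence "w k \<noteq> 0" by (cases "w k") auto
  hence "k < N" if "\<forall>k\<ge>N. w k = 0" using that by (meson not_less)
  thus ?thesis using False k by (auto simp: pleth_pn_schur_def adams_def)
qed

text \<open>Existence comes from the Kostka expansion, uniqueness from triangularity applied to the
  difference of two solutions. The second part holds for every list, so any linear functional on
  lists, such as pairing with e_kappa, can be applied to it.\<close>

lemma hall_pn_schur_expansion:
  assumes lam: "is_partition lam" and n: "n \<ge> 1"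
  defines "d \<equiv> n * psize lam"
  shows "hall_pn_schur n lam mu \<noteq> 0 \<Longrightarrow> mu \<in> partitions_of d"
    and "adams n (\<lambda>as. kostka as lam) xs
      = (\<Sum>p\<in>partitions_of d. hall_pn_schur n lam p * kostka xs p)"
proof -
  let ?F = "adams n (\<lambda>as. kostka as lam)"
  define good where "good c \<longleftrightarrow> (\<forall>p. c p \<noteq> 0 \<longrightarrow> is_partition p \<and> psize p = d) \<and>
      (\<forall>w. pleth_pn_schur d n lam w = (\<Sum>p\<in>partitions_of d. c p * schur_poly d p w))" for c
  obtain c0 where c0: "\<And>xs. ?F xs = (\<Sum>p\<in>partitions_of d. c0 p * kostka xs p)"
    using adams_kostka_expansion[OF lam, of n] unfolding d_def by blast
  \<comment> \<open>Uniqueness includes the values off the partitions of d, which have to be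
    0.\<close>
  define c where "c p = (if p \<in> partitions_of d then c0 p else 0)" for p
  have c: "?F xs = (\<Sum>p\<in>partitions_of d. c p * kostka xs p)" for xs
    unfolding c0 by (rule sum.cong) (auto simp: c_def)
  have eval: "(\<Sum>p\<in>partitions_of d. b p * schur_poly d p w) = (if \<forall>k\<ge>d. w k = 0
      then \<Sum>p\<in>partitions_of d. b p * kostka (weight_list d w) p else 0)" for b w
    by (auto intro!: sum.cong sum.neutral simp: schur_poly_eq_kostka)
  have "good c" unfolding good_def eval pleth_pn_schur_eq_adams[OF lam n] c
    by (auto simp: c_def)
  moreover have "b = c" if b: "good b" for b
  proof (rule ext, rule ccontr)
    fix m assume ne: "b m \<noteq> c m"
    hence m: "m \<in> partitions_of d" using b by (auto simp: good_def c_def)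
    have "False"
    proof (rule triangular.support_subset[OF triangular_dominance[of d], where c = "\<lambda>p. b p - c p"])
      show "m \<in> partitions_of d" by (rule m)
      show "b m - c m \<noteq> 0" using ne by simp
      fix q assume q: "q \<in> partitions_of d"
        and nz: "(\<Sum>p\<in>partitions_of d. (b p - c p) * kostka (weight_list d q) p) \<noteq> 0"
      have "\<forall>k\<ge>d. q k = 0" using q partition_le_psize(2)[of q] by auto
      moreover have "(\<Sum>p\<in>partitions_of d. b p * schur_poly d p q)
          = (\<Sum>p\<in>partitions_of d. c p * schur_poly d p q)"
        using b \<open>good c\<close> unfolding good_def by metis
      ultimately show False using nz by (simp add: eval left_diff_distrib sum_subtractf)
    qed
    thus False .
  qed
  ultimately have "(THE c. good c) = c" by (rule the_equality)
  hence hall: "hall_pn_schur n lam p = c p" for p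
    unfolding hall_pn_schur_def schur_coeff_def good_def d_def by simp
  show "hall_pn_schur n lam mu \<noteq> 0 \<Longrightarrow> mu \<in> partitions_of d"
    unfolding hall by (auto simp: c_def split: if_splits)
  show "?F xs = (\<Sum>p\<in>partitions_of d. hall_pn_schur n lam p * kostka xs p)"
    unfolding hall by (rule c)
qed

subsection \<open>Vertical strips\<close>

lemma psize_upd:
  assumes "\<And>i. M \<le> i \<Longrightarrow> q i = 0"
  shows "psize (q(j := v)) + q j = psize q + v"
proof -
  let ?L = "max M (Suc j)"
  have "psize q = (\<Sum>i<?L. q i)" using assms by (intro psize_eq_sum) auto
  moreover have "psize (q(j := v)) = (\<Sum>i<?L. (q(j := v)) i)"
    using assms by (intro psize_eq_sum) auto
  moreover have "(\<Sum>i<?L. q i) = q j + (\<Sum>i\<in>{..<?L} - {j}. q i)"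
    by (rule sum.remove) auto
  moreover have "(\<Sum>i<?L. (q(j := v)) i) = v + (\<Sum>i\<in>{..<?L} - {j}. q i)"
    by (subst sum.remove[of _ j]) (auto intro!: sum.cong)
  ultimately show ?thesis by simp
qed

text \<open>In chains r, q, p with q/r a horizontal and p/q a vertical strip, the last cell of the first
  row where r and p differ can be moved freely between the two strips.\<close>

definition toggle_row :: "(nat \<Rightarrow> nat) \<Rightarrow> (nat \<Rightarrow> nat) \<Rightarrow> nat" where
  "toggle_row p r = (LEAST j. r j \<noteq> p j)"

definition toggle :: "(nat \<Rightarrow> nat) \<Rightarrow> (nat \<Rightarrow> nat) \<Rightarrow> (nat \<Rightarrow> nat) \<Rightarrow> nat \<Rightarrow> nat" where
  "toggle p r q = (let j = toggle_row p r in q(j := if q j = p j then p j - 1 else p j))"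

text \<open>\<open>k > 0\<close> makes r differ from p, so the row j exists. Above it r and p agree,
  hence \<open>p j\<close> is at most the previous row of r and the last cell of row j may stay in
  q; since \<open>r j < p j\<close> it may also leave. As r is unchanged, a second toggle hits the
  same row, and i changes by exactly one.\<close>

lemma toggle:
  assumes p: "is_partition p" and q: "q \<in> vstrips (k - i) p" and r: "r \<in> hstrips i q"
    and ik: "i \<le> k" "k > 0"
  defines "q' \<equiv> toggle p r q"
  defines "i' \<equiv> psize q' - psize r"
  shows "i' \<le> k" "q' \<in> vstrips (k - i') p" "r \<in> hstrips i' q'" "toggle p r q' = q"
    and "(-1) ^ i' = - ((-1) ^ i :: int)"
proof -
  obtain M where M: "\<And>i. M \<le> i \<Longrightarrow> p i = 0" using partition_bound[OF p] by blast
  have qp: "q a \<le> p a" "p a \<le> Suc (q a)" for a using q by (auto simp: vstrips_def)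
  have rq: "r a \<le> q a" "q (Suc a) \<le> r a" for a using r by (auto simp: hstrips_def hstrip_def)
  have sz: "psize q + (k - i) = psize p" "psize r + i = psize q"
    using q r by (auto simp: vstrips_def hstrips_def)
  define j where "j = toggle_row p r"
  have "r \<noteq> p" using sz ik by auto
  hence "\<exists>j. r j \<noteq> p j" by auto
  hence rj: "r j \<noteq> p j" unfolding j_def toggle_row_def by (rule LeastI_ex)
  have below: "r a = p a" if "a < j" for a
    using not_less_Least[OF that[unfolded j_def toggle_row_def]] by blast
  have lt: "r j < p j" using rj rq(1)[of j] qp(1)[of j] by simp
  have q'_eq: "q' = q(j := if q j = p j then p j - 1 else p j)"
    by (simp add: q'_def toggle_def Let_def j_def)
  have qj: "q j = p j \<or> q j + 1 = p j" using qp[of j] by auto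
  have q'p: "q' a \<le> p a" "p a \<le> Suc (q' a)" for a
    using qp[of a] by (auto simp: q'_eq)
  have rq': "r a \<le> q' a" for a using rq(1)[of a] lt by (auto simp: q'_eq)
  have q'r: "q' (Suc a) \<le> r a" for a
  proof (cases "Suc a = j")
    case True
    have "p j \<le> p a" using p True by (auto simp: is_partition_def)
    thus ?thesis using below[of a] True by (auto simp: q'_eq)
  next
    case False
    thus ?thesis using rq(2)[of a] by (auto simp: q'_eq)
  qed
  have hs: "hstrip r q'" using rq' q'r by (simp add: hstrip_def)
  have "{a. q' a \<noteq> 0} \<subseteq> {a. p a \<noteq> 0}"
    using q'p(1) by (metis (mono_tags, lifting) Collect_mono le_zero_eq)
  hence "finite {a. q' a \<noteq> 0}"
    using p unfolding is_partition_def by (blast intro: finite_subset)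
  moreover have "q' (Suc a) \<le> q' a" for a using order_trans[OF q'r rq'] .
  ultimately have part: "is_partition q'" by (simp add: is_partition_def)
  have M': "q a = 0" "q' a = 0" if "M \<le> a" for a
    using M[OF that] qp(1)[of a] q'p(1)[of a] by auto
  have upd: "psize q' + q j = psize q + (if q j = p j then p j - 1 else p j)"
    unfolding q'_eq using M'(1) by (rule psize_upd)
  have size: "psize q' + 1 = psize q \<or> psize q' = psize q + 1"
    using upd qj lt by (auto split: if_splits)
  have le: "psize r \<le> psize q'" "psize q' \<le> psize p"
    by (rule psize_mono[of _ _ M], rule rq' q'p(1), erule M' M)+
  show "i' \<le> k" using le sz ik by (simp add: i'_def)
  thus "q' \<in> vstrips (k - i') p"
    using part q'p le sz ik by (simp add: vstrips_def i'_def)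
  show "r \<in> hstrips i' q'" using hs le by (simp add: hstrips_def i'_def)
  show "toggle p r q' = q"
    using qj lt by (auto simp: toggle_def Let_def j_def[symmetric] q'_eq fun_eq_iff)
  have "i' + 1 = i \<or> i' = i + 1" using size le sz by (auto simp: i'_def)
  thus "(-1) ^ i' = - ((-1) ^ i :: int)" by (elim disjE) auto
qed

text \<open>The identity that the sum of (-1)^i h_i e_(k-i) is 0 for k > 0, in adjoint form:
  \<open>toggle\<close> pairs triples of opposite sign and fixes r, so the terms cancel for any
  \<open>g\<close>.\<close>

lemma strips_alternating_sum:
  assumes p: "is_partition p" and k: "k > 0"
  shows "(\<Sum>i\<le>k. (-1) ^ i * (\<Sum>q\<in>vstrips (k - i) p. \<Sum>r\<in>hstrips i q. g r)) = (0 :: int)"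
proof -
  define S where "S = Sigma {..k} (\<lambda>i. Sigma (vstrips (k - i) p) (hstrips i))"
  define f :: "_ \<Rightarrow> int" where "f = (\<lambda>(i :: nat, q :: nat \<Rightarrow> nat, r). (-1) ^ i * g r)"
  define T where "T = (\<lambda>(i :: nat, q, r). (psize (toggle p r q) - psize r, toggle p r q, r))"
  have TS: "T x \<in> S \<and> T (T x) = x \<and> f (T x) = - f x" if "x \<in> S" for x
  proof -
    obtain i q r where x: "x = (i, q, r)" by (cases x)
    have *: "i \<le> k" "q \<in> vstrips (k - i) p" "r \<in> hstrips i q" using that by (auto simp: S_def x)
    note t = toggle[OF p *(2,3,1) k]
    have "psize q - psize r = i" using *(3) by (auto simp: hstrips_def)
    thus ?thesis using t by (simp add: x T_def S_def f_def)
  qed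
  have "sum f S = (\<Sum>x\<in>S. - f x)"
    by (rule sum.reindex_bij_witness[where i = T and j = T]) (use TS in auto)
  hence "sum f S = 0" by (simp add: sum_negf)
  moreover have "sum f S
      = (\<Sum>i\<le>k. (-1) ^ i * (\<Sum>q\<in>vstrips (k - i) p. \<Sum>r\<in>hstrips i q. g r))"
    unfolding S_def f_def sum_distrib_left
    using p by (simp add: sum.Sigma[symmetric] finite_strips vstrips_partition finite_SigmaI)
  ultimately show ?thesis by simp
qed

text \<open>Writing e_k as the alternating sum of the h_a over compositions a of k, alt_sum k F is the
  pairing with e_k of a symmetric function with monomial coefficients F.\<close>

fun alt_sum :: "nat \<Rightarrow> (nat list \<Rightarrow> int) \<Rightarrow> int" where
  "alt_sum 0 F = F []"
| "alt_sum (Suc k) F = (\<Sum>i\<le>k. (-1) ^ i * alt_sum (k - i) (\<lambda>as. F (as @ [Suc i])))"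

text \<open>Pairing with a product of e's: multiplying h's is concatenating their lists, so one
  block of letters is summed out for each factor.\<close>

fun alt_sums :: "nat list \<Rightarrow> (nat list \<Rightarrow> int) \<Rightarrow> int" where
  "alt_sums [] F = F []"
| "alt_sums (k # ks) F = alt_sums ks (\<lambda>bs. alt_sum k (\<lambda>as. F (as @ bs)))"

lemma alt_sum_linear:
  "alt_sum k (\<lambda>as. \<Sum>x\<in>A. c x * F x as) = (\<Sum>x\<in>A. c x * alt_sum k (F x))"
proof (induction k arbitrary: F rule: less_induct)
  case (less k)
  show ?case
  proof (cases k)
    case (Suc m)
    have "alt_sum k (\<lambda>as. \<Sum>x\<in>A. c x * F x as)
        = (\<Sum>i\<le>m. \<Sum>x\<in>A. c x * ((-1) ^ i * alt_sum (m - i) (\<lambda>as. F x (as @ [Suc i]))))"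
      unfolding Suc alt_sum.simps
    proof (rule sum.cong[OF refl])
      fix i
      have "alt_sum (m - i) (\<lambda>as. \<Sum>x\<in>A. c x * F x (as @ [Suc i]))
          = (\<Sum>x\<in>A. c x * alt_sum (m - i) (\<lambda>as. F x (as @ [Suc i])))"
        using less[of "m - i" "\<lambda>x as. F x (as @ [Suc i])"] Suc by simp
      thus "(-1) ^ i * alt_sum (m - i) (\<lambda>as. \<Sum>x\<in>A. c x * F x (as @ [Suc i]))
          = (\<Sum>x\<in>A. c x * ((-1) ^ i * alt_sum (m - i) (\<lambda>as. F x (as @ [Suc i]))))"
        by (simp add: sum_distrib_left mult.left_commute)
    qed
    also have "\<dots> = (\<Sum>x\<in>A. c x * alt_sum k (F x))"
      by (subst sum.swap) (simp add: Suc sum_distrib_left)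
    finally show ?thesis .
  qed simp
qed

lemma alt_sums_linear:
  "alt_sums ks (\<lambda>as. \<Sum>x\<in>A. c x * F x as) = (\<Sum>x\<in>A. c x * alt_sums ks (F x))"
proof (induction ks arbitrary: F)
  case (Cons k ks)
  show ?case
    unfolding alt_sums.simps alt_sum_linear[where F = "\<lambda>x as. F x (as @ _)"] by (rule Cons.IH)
qed simp

lemma alt_sum_scale: "alt_sum k (\<lambda>as. c * F as) = c * alt_sum k F"
  using alt_sum_linear[of k "\<lambda>_. c" "\<lambda>_. F" "{()}"] by simp

lemma alt_sums_scale: "alt_sums ks (\<lambda>as. c * F as) = c * alt_sums ks F"
  using alt_sums_linear[of ks "\<lambda>_. c" "\<lambda>_. F" "{()}"] by simp

text \<open>The recursion for e_k matches \<open>strips_alternating_sum\<close>: by induction its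
  summands are, up to sign, the terms with i > 0 of that vanishing sum, so together they equal the
  term i = 0.\<close>

lemma alt_sum_hop:
  assumes "is_partition p"
  shows "alt_sum k (\<lambda>as. hop as g p) = (\<Sum>q\<in>vstrips k p. g q)"
proof (induction k arbitrary: g rule: less_induct)
  case (less k)
  show ?case
  proof (cases k)
    case 0
    thus ?thesis using vstrips_0[OF assms] by simp
  next
    case (Suc m)
    let ?t = "\<lambda>i. (-1) ^ i * (\<Sum>q\<in>vstrips (k - i) p. \<Sum>r\<in>hstrips i q. g r)"
    have "alt_sum k (\<lambda>as. hop as g p)
        = (\<Sum>i\<le>m. (-1) ^ i * alt_sum (m - i) (\<lambda>as. hop as (hop [Suc i] g) p))"
      by (simp only: Suc alt_sum.simps hop_append)
    also have "\<dots> = (\<Sum>i\<le>m. - ?t (Suc i))"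
      using less Suc by (intro sum.cong) auto
    also have "\<dots> = - (\<Sum>i\<le>m. ?t (Suc i))" by (rule sum_negf)
    also have "\<dots> = ?t 0"
      using strips_alternating_sum[OF assms, of k g] Suc by (simp add: sum.atMost_Suc_shift del: sum.atMost_Suc)
    also have "\<dots> = (\<Sum>q\<in>vstrips k p. g q)"
      by (simp add: hstrips_0 vstrips_partition)
    finally show ?thesis .
  qed
qed

lemma alt_sums_kostka:
  assumes "is_partition p"
  shows "alt_sums ks (\<lambda>as. kostka as p) = kostka_conj ks p"
  using assms
proof (induction ks arbitrary: p)
  case (Cons k ks)
  have "alt_sum k (\<lambda>as. kostka (as @ bs) p) = (\<Sum>q\<in>vstrips k p. 1 * kostka bs q)" for bs
  proof -
    have "kostka (as @ bs) p = hop as (kostka bs) p" for as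
      by (simp add: kostka_def[abs_def] hop_append)
    thus ?thesis using alt_sum_hop[OF Cons.prems, of k "kostka bs"] by simp
  qed
  hence "alt_sums (k # ks) (\<lambda>as. kostka as p)
      = (\<Sum>q\<in>vstrips k p. 1 * alt_sums ks (\<lambda>bs. kostka bs q))"
    by (simp only: alt_sums.simps alt_sums_linear)
  thus ?case using Cons.IH vstrips_partition by simp
qed simp

text \<open>Up to sign, the adjoint of \<open>p_n \<circ> _\<close> sends e_k to e_(k/n), or to 0 if n does not divide k.\<close>

lemma alt_sum_adams:
  assumes n: "n \<ge> 1"
  shows "alt_sum k (adams n F)
    = (if n dvd k then (-1) ^ (k + k div n) * alt_sum (k div n) F else 0)"
proof (induction k arbitrary: F rule: less_induct)
  case (less k)
  show ?case
  proof (cases k)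
    case 0
    thus ?thesis by (simp add: adams_def)
  next
    case (Suc m)
    define t where "t i = (-1) ^ i * alt_sum (m - i) (\<lambda>as. adams n F (as @ [Suc i]))" for i
    have zero: "alt_sum l (\<lambda>_. 0) = 0" for l using alt_sum_scale[of l 0 "\<lambda>_. 0"] by simp
    have t: "t i = (if n dvd Suc i \<and> n dvd m - i then (-1) ^ i * ((-1) ^ (m - i + (m - i) div n)
        * alt_sum ((m - i) div n) (\<lambda>as. F (as @ [Suc i div n]))) else 0)" for i
    proof (cases "n dvd Suc i")
      case True
      hence "(\<lambda>as. adams n F (as @ [Suc i])) = adams n (\<lambda>as. F (as @ [Suc i div n]))"
        by (auto simp: adams_def fun_eq_iff)
      thus ?thesis using True less[of "m - i" "\<lambda>as. F (as @ [Suc i div n])"] Suc by (simp add: t_def)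
    next
      case False
      hence "(\<lambda>as. adams n F (as @ [Suc i])) = (\<lambda>_. 0)"
        by (auto simp: adams_def fun_eq_iff)
      thus ?thesis using False by (simp add: t_def zero)
    qed
    have k: "alt_sum k (adams n F) = (\<Sum>i\<le>m. t i)" by (simp add: Suc t_def)
    show ?thesis
    proof (cases "n dvd k")
      case False
      have "t i = 0" if "i \<le> m" for i
      proof -
        have "k = Suc i + (m - i)" using Suc that by simp
        hence "\<not> (n dvd Suc i \<and> n dvd m - i)" using False dvd_add by metis
        thus ?thesis unfolding t by (rule if_not_P)
      qed
      thus ?thesis using False by (simp add: k)
    next
      case True
      then obtain l where l: "k = n * Suc l" using Suc by (metis dvdE mult_0_right nat.exhaust nat.distinct(1))
      \<comment> \<open>A surviving index needs n to divide i + 1, so i = n(j+1) - 1; that n divides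
        m - i then follows from k = m + 1.\<close>
      define h where "h j = n * Suc j - 1" for j
      have h: "Suc (h j) = n * Suc j" for j using n by (simp add: h_def)
      have h_le: "h j \<le> m" if "j \<le> l" for j
      proof -
        have "n * Suc j \<le> n * Suc l" using that by (intro mult_le_mono2) simp
        hence "Suc (h j) \<le> Suc m" unfolding h Suc[symmetric] l .
        thus ?thesis by simp
      qed
      have hm: "m - h j = n * (l - j)" if "j \<le> l" for j
      proof -
        have "m - h j = n * Suc l - n * Suc j" using h[of j] Suc l by simp
        thus ?thesis by (simp add: diff_mult_distrib2[symmetric] del: mult_Suc_right)
      qed
      have "(\<Sum>i\<le>m. t i) = (\<Sum>i\<in>h ` {..l}. t i)"
      proof (rule sum.mono_neutral_right)
        show "h ` {..l} \<subseteq> {..m}"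
          using h_le by auto
        show "\<forall>i\<in>{..m} - h ` {..l}. t i = 0"
        proof
          fix i assume i: "i \<in> {..m} - h ` {..l}"
          have "\<not> n dvd Suc i"
          proof
            assume "n dvd Suc i"
            then obtain b where b: "Suc i = n * b" by (elim dvdE)
            then obtain j where j: "b = Suc j" by (cases b) simp_all
            have "Suc i \<le> Suc m" using i by simp
            hence "n * Suc j \<le> n * Suc l" unfolding b j Suc[symmetric] l .
            hence "j \<le> l" using n by (simp del: mult_Suc_right)
            moreover have "i = h j" using b j h[of j] by simp
            ultimately show False using i by blast
          qed
          thus "t i = 0" unfolding t by simp
        qed
      qed simp
      also have "\<dots> = (\<Sum>j\<le>l. t (h j))"
      proof (rule sum.reindex_cong[OF _ refl refl])
        show "inj_on h {..l}"
        proof (rule inj_onI)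
          fix a b assume "h a = h b"
          hence "n * Suc a = n * Suc b" by (metis h)
          thus "a = b" using n by simp
        qed
      qed
      also have "\<dots> = (\<Sum>j\<le>l. (-1) ^ (k + Suc l) * ((-1) ^ j * alt_sum (l - j) (\<lambda>as. F (as @ [Suc j]))))"
      proof (rule sum.cong[OF refl])
        fix j assume "j \<in> {..l}"
        hence j: "j \<le> l" by simp
        \<comment> \<open>The left exponent is m + (l - j), and k = m + 1, so both parities are that
          of m + l + j.\<close>
        have "even (h j + (m - h j + (l - j))) \<longleftrightarrow> even (k + Suc l + j)"
          using h_le[OF j] Suc j by (simp add: even_diff_nat)
        hence sign: "(-1) ^ h j * (-1) ^ (m - h j + (l - j)) = ((-1) ^ (k + Suc l) * (-1) ^ j :: int)"
          unfolding power_add[symmetric] by (simp only: minus_one_power_iff)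
        have "t (h j) = (-1) ^ h j * ((-1) ^ (m - h j + (l - j)) * alt_sum (l - j) (\<lambda>as. F (as @ [Suc j])))"
          using n unfolding t h hm[OF j] by simp
        thus "t (h j) = (-1) ^ (k + Suc l) * ((-1) ^ j * alt_sum (l - j) (\<lambda>as. F (as @ [Suc j])))"
          using sign by (metis mult.assoc)
      qed
      also have "\<dots> = (-1) ^ (k + Suc l) * alt_sum (Suc l) F"
        unfolding alt_sum.simps sum_distrib_left[symmetric] ..
      also have "Suc l = k div n" using l n by simp
      finally show ?thesis using True k by simp
    qed
  qed
qed

text \<open>Summing out one block leaves, up to the sign \<open>s\<close>, a function that is again
  of the form \<open>adams n\<close>; hence the induction runs over arbitrary
  \<open>F\<close>.\<close>

lemma alt_sums_adams_nonzero:
  assumes n: "n \<ge> 1" and nz: "alt_sums ks (adams n F) \<noteq> 0"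
  shows "(\<forall>k\<in>set ks. n dvd k) \<and> alt_sums (map (\<lambda>k. k div n) ks) F \<noteq> 0"
  using nz
proof (induction ks arbitrary: F)
  case Nil
  thus ?case by (simp add: adams_def)
next
  case (Cons k ks)
  have zero: "alt_sum k (\<lambda>_. 0) = 0" for k using alt_sum_scale[of k 0 "\<lambda>_. 0"] by simp
  have zeros: "alt_sums ks (\<lambda>_. 0) = 0" for ks using alt_sums_scale[of ks 0 "\<lambda>_. 0"] by simp
  define s :: int where "s = (-1) ^ (k + k div n)"
  define G where "G bs = alt_sum (k div n) (\<lambda>as. F (as @ bs))" for bs
  have inner: "alt_sum k (\<lambda>as. adams n F (as @ bs))
      = (if n dvd k then adams n (\<lambda>bs. s * G bs) bs else 0)" for bs
  proof (cases "\<forall>b\<in>set bs. n dvd b")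
    case True
    hence "(\<lambda>as. adams n F (as @ bs)) = adams n (\<lambda>as. F (as @ map (\<lambda>b. b div n) bs))"
      by (auto simp: adams_def fun_eq_iff)
    moreover have "adams n (\<lambda>bs. s * G bs) bs = s * G (map (\<lambda>b. b div n) bs)"
      using True by (simp add: adams_def)
    ultimately show ?thesis by (simp add: alt_sum_adams[OF n] s_def G_def)
  next
    case False
    hence "(\<lambda>as. adams n F (as @ bs)) = (\<lambda>_. 0)" "adams n (\<lambda>bs. s * G bs) bs = 0"
      by (auto simp: adams_def fun_eq_iff)
    thus ?thesis by (simp add: zero)
  qed
  have "n dvd k"
  proof (rule ccontr)
    assume "\<not> n dvd k"
    thus False using Cons.prems by (simp add: inner zeros)
  qed
  moreover from this have "alt_sums ks (adams n (\<lambda>bs. s * G bs)) \<noteq> 0"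
    using Cons.prems by (simp add: inner)
  hence "(\<forall>k\<in>set ks. n dvd k) \<and> alt_sums (map (\<lambda>k. k div n) ks) (\<lambda>bs. s * G bs) \<noteq> 0"
    by (rule Cons.IH)
  hence "(\<forall>k\<in>set ks. n dvd k) \<and> alt_sums (map (\<lambda>k. k div n) ks) G \<noteq> 0"
    by (auto simp: alt_sums_scale)
  ultimately show ?case by (simp add: G_def[abs_def])
qed

subsection \<open>Conjugate partitions\<close>

text \<open>The first c columns of p. Their size is the c-th partial sum of the conjugate, so
  conjugates can be compared in dominance order through p itself.\<close>

abbreviation truncate :: "nat \<Rightarrow> (nat \<Rightarrow> nat) \<Rightarrow> nat \<Rightarrow> nat" where
  "truncate c p \<equiv> \<lambda>i. min (p i) c"

lemma partition_truncate:
  assumes "is_partition p"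
  shows "is_partition (truncate c p)"
proof -
  have "finite {i. truncate c p i \<noteq> 0}"
    by (rule finite_subset[of _ "{i. p i \<noteq> 0}"]) (use assms in \<open>auto simp: is_partition_def\<close>)
  thus ?thesis using assms by (auto simp: is_partition_def min_le_iff_disj)
qed

lemma truncate_id: "(\<And>i. p i \<le> c) \<Longrightarrow> truncate c p = p"
  by (simp add: fun_eq_iff min_absorb1)

lemma psize_truncate_mono:
  assumes "is_partition p" "\<And>i. q i \<le> p i"
  shows "psize (truncate c q) \<le> psize (truncate c p)"
proof -
  obtain M where M: "\<And>i. M \<le> i \<Longrightarrow> p i = 0" using partition_bound[OF assms(1)] by blast
  show ?thesis by (rule psize_mono[of _ _ M]) (use assms M in \<open>auto simp: min_le_iff_disj\<close>)
qed

lemma psize_truncate_Suc: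
  assumes "is_partition p"
  shows "psize (truncate (Suc c) p) = psize (truncate c p) + conjp p c"
proof -
  obtain M where M: "\<And>i. M \<le> i \<Longrightarrow> p i = 0" using partition_bound[OF assms] by blast
  have "{i. c < p i} = {i \<in> {..<M}. c < p i}"
    using M by (auto simp: not_less[symmetric]) (metis not_less not_less_zero)
  hence "conjp p c = (\<Sum>i<M. of_bool (c < p i))"
    by (simp add: conjp_def sum.inter_filter[symmetric] of_bool_def if_distrib cong: if_cong)
  moreover have "psize (truncate b p) = (\<Sum>i<M. truncate b p i)" for b
    using M by (intro psize_eq_sum) simp
  ultimately show ?thesis
    by (simp only: sum.distrib[symmetric]) (auto intro!: sum.cong)
qed

lemma sum_conjp:
  assumes "is_partition p"
  shows "(\<Sum>j<c. conjp p j) = psize (truncate c p)"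
  by (induction c) (simp_all add: psize_truncate_Suc[OF assms])

lemma conjp_zero:
  assumes "is_partition p" "psize p \<le> j"
  shows "conjp p j = 0"
proof -
  have "{i. j < p i} = {}" using partition_le_psize(1)[OF assms(1)] assms(2)
    by (auto simp: not_less intro: order_trans)
  thus ?thesis by (simp add: conjp_def)
qed

lemma conjp_antimono:
  assumes "is_partition p" "i \<le> j"
  shows "conjp p j \<le> conjp p i"
proof -
  have "finite {k. i < p k}"
    by (rule finite_subset[of _ "{k. p k \<noteq> 0}"]) (use assms in \<open>auto simp: is_partition_def\<close>)
  thus ?thesis unfolding conjp_def using assms(2) by (intro card_mono) auto
qed

text \<open>The rows reaching past column j form an initial segment. Thus p can be recovered from
  its conjugate, which makes the column order antisymmetric.\<close>

lemma less_conjp_iff: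
  assumes "is_partition p"
  shows "i < conjp p j \<longleftrightarrow> j < p i"
proof -
  define A where "A = {i. j < p i}"
  have fin: "finite A" unfolding A_def
    by (rule finite_subset[of _ "{k. p k \<noteq> 0}"]) (use assms in \<open>auto simp: is_partition_def\<close>)
  have down: "a \<in> A" if "b \<in> A" "a \<le> b" for a b
    using that partition_antimono[OF assms that(2)] by (auto simp: A_def)
  have "A = {..<card A}" using fin down by (rule initial_segment_eq_lessThan_card)
  thus ?thesis unfolding conjp_def A_def by blast
qed

text \<open>A vertical strip shortens each row by at most one, so M strips can exhaust only rows of
  length at most M. Truncation is monotone, so the inequalities for q pass to p; the last one is an
  equality of sizes.\<close>

lemma kostka_conj_dominance:
  assumes "is_partition p" "kostka_conj (weight_list M w) p \<noteq> 0"
  shows "\<forall>i. p i \<le> M" "psize p = (\<Sum>j<M. w j)"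
    and "\<forall>c\<le>M. (\<Sum>j<c. w j) \<le> psize (truncate c p)"
proof -
  have "(\<forall>i. p i \<le> M) \<and> psize p = (\<Sum>j<M. w j) \<and> (\<forall>c\<le>M. (\<Sum>j<c. w j) \<le> psize (truncate c p))"
    using assms
  proof (induction M arbitrary: p)
    case (Suc M)
    then obtain q where q: "q \<in> vstrips (w M) p" "kostka_conj (weight_list M w) q \<noteq> 0"
      by (auto elim: sum.not_neutral_contains_not_neutral)
    note IH = Suc.IH[OF vstrips_partition[OF q(1)] q(2)]
    have qp: "q i \<le> p i" "p i \<le> Suc (q i)" for i using q(1) by (auto simp: vstrips_def)
    have le: "p i \<le> Suc M" for i using qp(2)[of i] IH by (meson Suc_le_mono order_trans)
    have sz: "psize p = (\<Sum>j<Suc M. w j)" using IH q(1) by (simp add: vstrips_def)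
    have "(\<Sum>j<c. w j) \<le> psize (truncate c p)" if "c \<le> Suc M" for c
    proof (cases "c = Suc M")
      case True
      thus ?thesis using sz truncate_id[of p "Suc M"] le by simp
    next
      case False
      hence "(\<Sum>j<c. w j) \<le> psize (truncate c q)" using IH that by simp
      also have "\<dots> \<le> psize (truncate c p)" by (rule psize_truncate_mono[OF Suc.prems(1) qp(1)])
      finally show ?thesis .
    qed
    thus ?case using le sz by blast
  qed (auto split: if_splits)
  thus "\<forall>i. p i \<le> M" "psize p = (\<Sum>j<M. w j)"
    "\<forall>c\<le>M. (\<Sum>j<c. w j) \<le> psize (truncate c p)" by auto
qed

lemma kostka_conj_nonneg: "kostka_conj ks p \<ge> 0"
  by (induction ks arbitrary: p) (auto intro: sum_nonneg)

text \<open>Removing the last column at every step is one admissible chain, and the other chains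
  contribute nonnegatively, so nothing cancels it.\<close>

lemma kostka_conj_diagonal:
  assumes p: "is_partition p"
  shows "kostka_conj (weight_list M (conjp p)) (truncate M p) > 0"
proof (induction M)
  case (Suc M)
  have fin: "finite (vstrips (conjp p M) (truncate (Suc M) p))"
    by (rule finite_strips(3)[OF partition_truncate[OF p]])
  have "truncate M p \<in> vstrips (conjp p M) (truncate (Suc M) p)"
    using partition_truncate[OF p] psize_truncate_Suc[OF p] by (auto simp: vstrips_def)
  from member_le_sum[OF this _ fin, of "kostka_conj (weight_list M (conjp p))"]
  show ?case using Suc by (auto simp: kostka_conj_nonneg)
qed simp

text \<open>M may exceed d because the bound for the first c columns needs a weight list reaching
  column c. By \<open>d \<le> M\<close>, truncation at M changes no partition of d.\<close>

lemma triangular_conj_dominance: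
  assumes "d \<le> M"
  shows "triangular (partitions_of d) (\<lambda>p q. \<forall>c. psize (truncate c p) \<le> psize (truncate c q))
     (\<lambda>p q. kostka_conj (weight_list M (conjp q)) p)"
proof
  show "Finite_Set.finite (partitions_of d)" by (rule finite_partitions)
  show "\<forall>c. psize (truncate c p) \<le> psize (truncate c s)"
    if "\<forall>c. psize (truncate c p) \<le> psize (truncate c q)" "\<forall>c. psize (truncate c q) \<le> psize (truncate c s)"
    for p q s :: "nat \<Rightarrow> nat" using that order_trans by blast
  show "p = q"
    if pq: "p \<in> partitions_of d" "q \<in> partitions_of d"
      and le: "\<forall>c. psize (truncate c p) \<le> psize (truncate c q)" "\<forall>c. psize (truncate c q) \<le> psize (truncate c p)"
    for p q
  proof
    fix i
    have eq: "psize (truncate c p) = psize (truncate c q)" for c using le by (simp add: le_antisym)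
    have "conjp p j = conjp q j" for j
      using eq[of j] eq[of "Suc j"] pq by (simp add: psize_truncate_Suc)
    hence "j < p i \<longleftrightarrow> j < q i" for j using pq less_conjp_iff[of p i j] less_conjp_iff[of q i j] by auto
    thus "p i = q i" by (meson nat_neq_iff)
  qed
  show "\<forall>c. psize (truncate c q) \<le> psize (truncate c p)"
    if pq: "p \<in> partitions_of d" "q \<in> partitions_of d" and nz: "kostka_conj (weight_list M (conjp q)) p \<noteq> 0"
    for p q
  proof
    fix c
    show "psize (truncate c q) \<le> psize (truncate c p)"
    proof (cases "c \<le> M")
      case True
      thus ?thesis using kostka_conj_dominance(3)[OF _ nz] pq sum_conjp[of q c] by auto
    next
      case False
      hence "truncate c p = p" "truncate c q = q"
      proof -
        have "p i \<le> c" "q i \<le> c" for i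
          using pq assms False partition_le_psize(1)[of p i] partition_le_psize(1)[of q i] by auto
        thus "truncate c p = p" "truncate c q = q" by (simp_all add: truncate_id)
      qed
      thus ?thesis using pq by simp
    qed
  qed
  show "kostka_conj (weight_list M (conjp p)) p \<noteq> 0" if "p \<in> partitions_of d" for p
  proof -
    have "truncate M p = p"
      using that assms partition_le_psize(1)[of p] by (auto intro!: truncate_id intro: order_trans)
    thus ?thesis using kostka_conj_diagonal[of p M] that by auto
  qed
qed

subsection \<open>Dominance bounds\<close>

text \<open>The exponents of a monomial of p_n o s_lam are divisible by n, and the quotients are a
  weight of s_lam, hence dominated by lam. \<open>support_subset\<close> carries the bound from
  exponents to constituents.\<close>

lemma hall_pn_schur_rows:
  assumes n: "n \<ge> 1" and lam: "is_partition lam" and nz: "hall_pn_schur n lam mu \<noteq> 0"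
  shows "(\<Sum>i<r. mu i) \<le> n * (\<Sum>i<r. lam i)"
proof -
  define d where "d = n * psize lam"
  note expansion = hall_pn_schur_expansion[OF lam n, folded d_def]
  have "\<forall>r. (\<Sum>i<r. mu i) \<le> n * (\<Sum>i<r. lam i)"
  proof (rule triangular.support_subset[OF triangular_dominance[of d],
        where c = "hall_pn_schur n lam" and m = mu and P = "\<lambda>q. \<forall>r. (\<Sum>i<r. q i) \<le> n * (\<Sum>i<r. lam i)"])
    show "mu \<in> partitions_of d" "hall_pn_schur n lam mu \<noteq> 0" using expansion(1) nz by auto
    show "\<forall>r. (\<Sum>i<r. q i) \<le> n * (\<Sum>i<r. lam i)"
      if "\<forall>r. (\<Sum>i<r. p i) \<le> n * (\<Sum>i<r. lam i)" "\<forall>r. (\<Sum>i<r. q i) \<le> (\<Sum>i<r. p i)"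
      for p q :: "nat \<Rightarrow> nat" using that order_trans by blast
    fix q assume q: "q \<in> partitions_of d"
      and "(\<Sum>p\<in>partitions_of d. hall_pn_schur n lam p * kostka (weight_list d q) p) \<noteq> 0"
    hence "adams n (\<lambda>as. kostka as lam) (weight_list d q) \<noteq> 0" unfolding expansion(2) by blast
    hence dvd: "\<forall>i<d. n dvd q i" and nz': "kostka (weight_list d (\<lambda>i. q i div n)) lam \<noteq> 0"
      by (auto simp: adams_def comp_def split: if_splits)
    have le: "(\<Sum>i<r. q i) \<le> n * (\<Sum>i<r. lam i)" if "r \<le> d" for r
    proof -
      have "(\<Sum>i<r. q i) = n * (\<Sum>i<r. q i div n)"
        unfolding sum_distrib_left using dvd that by (intro sum.cong) auto
      also have "\<dots> \<le> n * (\<Sum>i<r. lam i)"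
        using kostka_dominance(2)[OF lam nz'] that by (intro mult_le_mono2) blast
      finally show ?thesis .
    qed
    show "\<forall>r. (\<Sum>i<r. q i) \<le> n * (\<Sum>i<r. lam i)"
    proof
      fix r
      \<comment> \<open>Past d rows both sides equal d, since \<open>n \<ge> 1\<close> gives
        \<open>psize lam \<le> d\<close>.\<close>
      show "(\<Sum>i<r. q i) \<le> n * (\<Sum>i<r. lam i)"
      proof (cases "r \<le> d")
        case False
        have "psize lam \<le> d" using n by (simp add: d_def)
        hence "(\<Sum>i<r. lam i) = psize lam" using False by (intro partition_sum_lessThan[OF lam]) simp
        thus ?thesis using False q partition_sum_lessThan[of q r] by (simp add: d_def)
      qed (rule le)
    qed
  qed
  thus ?thesis ..
qed

lemma hall_pn_schur_columns:
  assumes n: "n \<ge> 1" and lam: "is_partition lam" and nz: "hall_pn_schur n lam mu \<noteq> 0"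
  shows "(\<Sum>j<c. conjp mu j) \<le> n * (\<Sum>j<c. conjp lam j)"
proof -
  define d where "d = n * psize lam"
  \<comment> \<open>Triangularity requires \<open>d \<le> M\<close>, the dominance inequality at
    column c requires \<open>c \<le> M\<close>.\<close>
  define M where "M = d + c"
  note expansion = hall_pn_schur_expansion[OF lam n, folded d_def]
  have mu: "mu \<in> partitions_of d" using expansion(1) nz by blast
  have "psize (truncate c mu) \<le> n * psize (truncate c lam)"
  proof (rule triangular.support_subset[OF triangular_conj_dominance[of d M],
        where c = "hall_pn_schur n lam" and m = mu and P = "\<lambda>q. psize (truncate c q) \<le> n * psize (truncate c lam)"])
    show "d \<le> M" by (simp add: M_def)
    show "mu \<in> partitions_of d" "hall_pn_schur n lam mu \<noteq> 0" using mu nz by auto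
    show "psize (truncate c q) \<le> n * psize (truncate c lam)"
      if "psize (truncate c p) \<le> n * psize (truncate c lam)"
        "\<forall>c. psize (truncate c q) \<le> psize (truncate c p)"
      for p q using that order_trans by blast
    fix q assume q: "q \<in> partitions_of d"
      and nz': "(\<Sum>p\<in>partitions_of d. hall_pn_schur n lam p * kostka_conj (weight_list M (conjp q)) p) \<noteq> 0"
    let ?ks = "weight_list M (conjp q)"
    \<comment> \<open>Pairing the Schur expansion with e_kappa, kappa the conjugate of q, turns the
      triangular sum into a quantity that vanishes unless n divides every column length of
      q.\<close>
    have "alt_sums ?ks (adams n (\<lambda>as. kostka as lam))
        = alt_sums ?ks (\<lambda>as. \<Sum>p\<in>partitions_of d. hall_pn_schur n lam p * kostka as p)"
      by (rule arg_cong[where f = "alt_sums ?ks"]) (rule ext, rule expansion(2))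
    also have "\<dots> = (\<Sum>p\<in>partitions_of d. hall_pn_schur n lam p * alt_sums ?ks (\<lambda>as. kostka as p))"
      by (rule alt_sums_linear)
    also have "\<dots> = (\<Sum>p\<in>partitions_of d. hall_pn_schur n lam p * kostka_conj ?ks p)"
      by (intro sum.cong refl) (simp add: alt_sums_kostka)
    finally have "alt_sums ?ks (adams n (\<lambda>as. kostka as lam)) \<noteq> 0" using nz' by simp
    from alt_sums_adams_nonzero[OF n this]
    have dvd: "\<forall>j<M. n dvd conjp q j"
      and nz'': "kostka_conj (weight_list M (\<lambda>j. conjp q j div n)) lam \<noteq> 0"
      by (auto simp: alt_sums_kostka[OF lam] comp_def)
    have "psize (truncate c q) = (\<Sum>j<c. conjp q j)" using sum_conjp[of q c] q by simp
    also have "\<dots> = n * (\<Sum>j<c. conjp q j div n)"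
      unfolding sum_distrib_left using dvd by (intro sum.cong) (auto simp: M_def)
    also have "\<dots> \<le> n * psize (truncate c lam)"
      using kostka_conj_dominance(3)[OF lam nz''] by (intro mult_le_mono2) (simp add: M_def)
    finally show "psize (truncate c q) \<le> n * psize (truncate c lam)" .
  qed
  thus ?thesis using sum_conjp[OF lam] sum_conjp[of mu] mu by simp
qed

lemma psize_eq_sum_plus_ptail:
  assumes "finite {i. p i \<noteq> 0}"
  shows "psize p = (\<Sum>i<r. p i) + ptail p r"
proof -
  have split: "{i. p i \<noteq> 0} = {i. i < r \<and> p i \<noteq> 0} \<union> {i. r \<le> i \<and> p i \<noteq> 0}" by auto
  have "psize p = (\<Sum>i | i < r \<and> p i \<noteq> 0. p i) + ptail p r"
    unfolding psize_def ptail_def split using assms by (intro sum.union_disjoint) auto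
  also have "(\<Sum>i | i < r \<and> p i \<noteq> 0. p i) = (\<Sum>i<r. p i)"
    by (rule sum.mono_neutral_left) auto
  finally show ?thesis .
qed

text \<open>The r-th part is the least of the first r, so r times it is at most their sum; and n
  times (size minus tail) is at most n times the size minus one tail, as \<open>n \<ge> 1\<close>.
  Plain functions are used so that it serves both \<open>lam\<close> and
  \<open>conjp lam\<close>.\<close>

lemma part_bound_of_dominance:
  assumes "\<And>i j. i \<le> j \<Longrightarrow> mu j \<le> mu i" "finite {i. lam i \<noteq> 0}" "n \<ge> 1" "r \<ge> 1"
    and "(\<Sum>i<r. mu i) \<le> n * (\<Sum>i<r. lam i)"
  shows "mu (r - 1) \<le> (n * psize lam - ptail lam r) div r"
proof -
  have "r * mu (r - 1) = (\<Sum>i<r. mu (r - 1))" by simp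
  also have "\<dots> \<le> (\<Sum>i<r. mu i)" using assms(1) by (intro sum_mono) auto
  also have "\<dots> \<le> n * (\<Sum>i<r. lam i)" by fact
  also have "\<dots> \<le> n * psize lam - ptail lam r"
  proof -
    have "ptail lam r \<le> n * ptail lam r" using assms(3) by simp
    thus ?thesis unfolding psize_eq_sum_plus_ptail[OF assms(2), of r] distrib_left by linarith
  qed
  finally show ?thesis using assms(4) by (simp add: less_eq_div_iff_mult_less_eq mult.commute)
qed

lemma psize_conjp:
  assumes "is_partition p"
  shows "psize (conjp p) = psize p"
proof -
  have "psize (conjp p) = (\<Sum>j<psize p. conjp p j)"
    using conjp_zero[OF assms] by (rule psize_eq_sum)
  also have "\<dots> = psize (truncate (psize p) p)" by (rule sum_conjp[OF assms])
  also have "truncate (psize p) p = p" by (rule truncate_id) (rule partition_le_psize(1)[OF assms])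
  finally show ?thesis .
qed

theorem mainTheorem4:
  fixes n :: nat and lam mu :: "nat \<Rightarrow> nat"
  assumes "n \<ge> 1"
    and "is_partition lam" and "is_partition mu"
    and "hall_pn_schur n lam mu \<noteq> 0"
  shows "(\<forall>r\<ge>1. mu (r - 1) \<le> (n * psize lam - ptail lam r) div r) \<and>
         (\<forall>c\<ge>1. conjp mu (c - 1) \<le> (n * psize lam - ptail (conjp lam) c) div c)"
proof (intro conjI allI impI)
  have fin: "finite {i. lam i \<noteq> 0}" using assms(2) by (simp add: is_partition_def)
  fix r :: nat assume r: "r \<ge> 1"
  show "mu (r - 1) \<le> (n * psize lam - ptail lam r) div r"
    by (rule part_bound_of_dominance[OF _ fin assms(1) r hall_pn_schur_rows[OF assms(1,2,4)]])
      (rule partition_antimono[OF assms(3)])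
next
  have "j < psize lam" if "conjp lam j \<noteq> 0" for j
    using conjp_zero[OF assms(2), of j] that by (cases "j < psize lam") auto
  hence "{j. conjp lam j \<noteq> 0} \<subseteq> {..<psize lam}" by blast
  hence fin: "finite {j. conjp lam j \<noteq> 0}" by (rule finite_subset) simp
  fix c :: nat assume c: "c \<ge> 1"
  show "conjp mu (c - 1) \<le> (n * psize lam - ptail (conjp lam) c) div c"
    unfolding psize_conjp[OF assms(2), symmetric]
    by (rule part_bound_of_dominance[OF _ fin assms(1) c hall_pn_schur_columns[OF assms(1,2,4)]])
      (rule conjp_antimono[OF assms(3)])
qed

end
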